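(* Let $O\subseteq\{=,\ne,\le,\not\le\}$ and let $K$ be a positive, commutative semiring (ordered if $\le$ or $\not\le\in O$). Then, for $K$-interpretations $\pi\colon\mathrm{Lit}_{A,\tau}\to K$ where $A$ is strictly ordered, $$\mathrm{FO}_K(O,\mathrm{Arb}_K)=\mathrm{FAC}^0_K[O].$$
   Context: Semiring notions: commutative ($\cdot$ commutative), positive (no zero divisors; $a+b=0\Rightarrow a=b=0$), ordered (partial order $\le$ with $a\le b\Rightarrow a+c\le b+c$ and $0\le a,0\le b\Rightarrow 0\le ab$); $0\ne1$. Circuits: an arithmetic circuit over $K$ is a connected DAG with ordered input gates (indegree $0$, holding inputs), constant gates (indegree $0$, labelled by elements of $K$), $+$ and $\times$ gates of unbounded fan-in, output gates (each taking the value of its single predecessor), and, for each $\circ\in O$, gates with two ordered inputs $a,b$ outputting $1$ if $a\circ b$ and $0$ otherwise. $\mathrm{FAC}^0_K[O]$ is the class of functions $f\colon K^*\to K$ computed by (non-uniform) circuit families $(C_n)_n$ (with $f(x)=f_{C_{|x|}}(x)$) of size $\mathcal O(n^{\mathcal O(1)})$ and depth $\mathcal O(1)$. Logic: $\mathrm{FO}(O)$ over a relational vocabulary $\tau$: $\phi::=\alpha\mid\alpha\circ\alpha\ (\circ\in O)\mid\phi\wedge\phi\mid\phi\vee\phi\mid\exists x\phi\mid\forall x\phi$, with $\alpha::=x=y\mid x\ne y\mid R(\bar x)\mid\neg R(\bar x)\mid\alpha\wedge\alpha\mid\alpha\vee\alpha\mid\exists x\alpha\mid\forall x\alpha$. For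 a finite strictly ordered set $A$, a $K$-interpretation is $\pi\colon\mathrm{Lit}_{A,\tau}\to K$ on literals $R(\bar a),\neg R(\bar a)$. Semantics under assignment $s$: $x=y$, $x\ne y$ give $1$/$0$; literals get their $\pi$-values; $\wedge\mapsto\cdot$, $\vee\mapsto+$, $\exists x\mapsto\sum_{a\in A}$, $\forall x\mapsto\prod_{a\in A}$; $[\![\phi\circ\psi]\!]=1$ if $[\![\phi]\!]\circ[\![\psi]\!]$ holds in $K$, else $0$. $\mathrm{Arb}_K=\bigcup_{k\in\mathbb N}\{(f_n)_{n\in\mathbb N}\mid f_n\colon\{1,\dots,n\}^k\to K\}$. For $F\subseteq\mathrm{Arb}_K$, $\mathrm{FO}(O,F)$ formulas over a signature $(\tau,\sigma)$ ($\tau,\sigma$ finite relational) additionally allow atoms $P(\bar x)$, $\neg P(\bar x)$ (in $\alpha$) for $P\in\sigma$. A family $\rho=(\rho_n)_n$ of $K$-interpretations of $\sigma$ is fixed such that for each $P\in\sigma$ there are $(f_n),(f'_n)\in F$ with $\rho_n(P(\bar a))=f_n(\bar a)$, $\rho_n(\neg P(\bar a))=f'_n(\bar a)$ for all $\bar a\in\{1,\dots,n\}^{\mathrm{ar}(P)}$; then $[\![P(\bar x)]\!]_{\pi,\rho,s}=\rho_{|A|}(P(r(s(\bar x))))$ and $[\![\neg P(\bar x)]\!]_{\pi,\rho,s}=\rho_{|A|}(\neg P(r(s(\bar x))))$, with $r\colon A\to\{1,\dots,|A|\}$ the rank function of the order on $A$. Encoding: listing $\mathrm{Lit}_{A,\tau}=\{\ell_1,\dots,\ell_n\}$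 in a fixed order, $\mathit{enc}(\pi)=(\pi(\ell_1),\dots,\pi(\ell_n))\in K^*$, where literals of $0$-ary symbols are encoded as if the symbol were unary ($|A|$ copies). For a sentence $\varphi$ of $\mathrm{FO}(O,F,\rho)$, $\mathrm{FO}_K(O,F)\text{-EVAL}_\varphi$ is the function $\mathit{enc}(\pi)\mapsto[\![\varphi]\!]_{\pi,\rho}$, and $\mathrm{FO}_K(O,F)$ is the set of all such functions (over all sentences $\varphi$ and admissible $\rho$).
   Formalization: Comparisons φ∘ψ are allowed between arbitrary formulas (nested), as in the semantic clause, not only between comparison-free α; with the literal grammar the equality fails, e.g. K=ℕ, O={=}. Classes are compared on encodings of nonempty A and nonempty τ. *)

theory Defs
  imports Complex_Main "HOL-Library.FuncSet" "HOL-Library.Landau_Symbols"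
begin

section \<open>Semirings and comparisons\<close>

text \<open>
  A commutative semiring with \<open>0 \<noteq> 1\<close> is a type of class \<open>comm_semiring_1\<close>. The partial order is an
  explicit relation \<open>le\<close>, because it is only present when \<open>\<le>\<close> or \<open>\<not>\<le>\<close> is one of the allowed
  comparisons.
\<close>

definition positive_semiring :: "'k::comm_semiring_1 itself \<Rightarrow> bool" where
  "positive_semiring _ \<longleftrightarrow>
     (\<forall>a b :: 'k. a * b = 0 \<longrightarrow> a = 0 \<or> b = 0) \<and>
     (\<forall>a b :: 'k. a + b = 0 \<longrightarrow> a = 0 \<and> b = 0)"

definition semiring_order :: "('k::comm_semiring_1 \<Rightarrow> 'k \<Rightarrow> bool) \<Rightarrow> bool" where
  "semiring_order le \<longleftrightarrow>
     reflp le \<and> antisymp le \<and> transp le \<and>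
     (\<forall>a b c. le a b \<longrightarrow> le (a + c) (b + c)) \<and>
     (\<forall>a b. le 0 a \<longrightarrow> le 0 b \<longrightarrow> le 0 (a * b))"

datatype cmp = EQ | NEQ | LE | NLE

fun cmp_holds :: "('k \<Rightarrow> 'k \<Rightarrow> bool) \<Rightarrow> cmp \<Rightarrow> 'k \<Rightarrow> 'k \<Rightarrow> bool" where
  "cmp_holds le EQ a b \<longleftrightarrow> a = b"
| "cmp_holds le NEQ a b \<longleftrightarrow> a \<noteq> b"
| "cmp_holds le LE a b \<longleftrightarrow> le a b"
| "cmp_holds le NLE a b \<longleftrightarrow> \<not> le a b"

section \<open>Arithmetic circuits\<close>

text \<open>
  Gates are named by natural numbers, and the label of a gate lists its predecessors: a set for the
  (unordered, unbounded fan-in) arithmetic gates, an ordered pair for comparison gates, a single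
  gate for output gates. \<open>In i\<close> holds the \<open>i\<close>-th input, counted from \<open>0\<close>.
\<close>

datatype 'k label =
    In nat
  | Const 'k
  | Plus "nat set"
  | Times "nat set"
  | Compare cmp nat nat
  | Out nat

record 'k circuit =
  gates :: "nat set"
  label :: "nat \<Rightarrow> 'k label"

fun preds :: "'k label \<Rightarrow> nat set" where
  "preds (In i) = {}"
| "preds (Const c) = {}"
| "preds (Plus S) = S"
| "preds (Times S) = S"
| "preds (Compare oper a b) = {a, b}"
| "preds (Out a) = {a}"

fun is_Out :: "'k label \<Rightarrow> bool" where
  "is_Out (Out a) \<longleftrightarrow> True"
| "is_Out _ \<longleftrightarrow> False"

definition edges :: "'k circuit \<Rightarrow> nat rel" where
  "edges C = {(h, g). g \<in> gates C \<and> h \<in> preds (label C g)}"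

text \<open>
  Circuits over the comparisons in \<open>Ops\<close> with \<open>n\<close> inputs and one output. As the functions considered
  have values in \<open>K\<close>, there is exactly one output gate.
\<close>

definition arith_circuit :: "cmp set \<Rightarrow> nat \<Rightarrow> 'k circuit \<Rightarrow> bool" where
  "arith_circuit Ops n C \<longleftrightarrow>
     finite (gates C) \<and>
     edges C \<subseteq> gates C \<times> gates C \<and>
     acyclic (edges C) \<and>
     (\<forall>g\<in>gates C. \<forall>h\<in>gates C. (g, h) \<in> (edges C \<union> (edges C)\<inverse>)\<^sup>*) \<and>
     (\<forall>g\<in>gates C. \<forall>i. label C g = In i \<longrightarrow> i < n) \<and>
     (\<forall>i<n. \<exists>!g. g \<in> gates C \<and> label C g = In i) \<and>
     (\<forall>g\<in>gates C. \<forall>oper a b. label C g = Compare oper a b \<longrightarrow> oper \<in> Ops) \<and>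
     (\<exists>!g. g \<in> gates C \<and> is_Out (label C g)) \<and>
     (\<forall>(h, g)\<in>edges C. \<not> is_Out (label C h))"

definition gate_value ::
    "('k::comm_semiring_1 \<Rightarrow> 'k \<Rightarrow> bool) \<Rightarrow> 'k circuit \<Rightarrow> 'k list \<Rightarrow> nat \<Rightarrow> 'k" where
  "gate_value le C x = wfrec (edges C) (\<lambda>v g.
     case label C g of
       In i \<Rightarrow> x ! i
     | Const c \<Rightarrow> c
     | Plus S \<Rightarrow> (\<Sum>h\<in>S. v h)
     | Times S \<Rightarrow> (\<Prod>h\<in>S. v h)
     | Compare oper a b \<Rightarrow> (if cmp_holds le oper (v a) (v b) then 1 else 0)
     | Out a \<Rightarrow> v a)"

definition circuit_fun ::
    "('k::comm_semiring_1 \<Rightarrow> 'k \<Rightarrow> bool) \<Rightarrow> 'k circuit \<Rightarrow> 'k list \<Rightarrow> 'k" where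
  "circuit_fun le C x = gate_value le C x (THE g. g \<in> gates C \<and> is_Out (label C g))"

definition circuit_size :: "'k circuit \<Rightarrow> nat" where
  "circuit_size C = card (gates C)"

definition circuit_depth :: "'k circuit \<Rightarrow> nat" where
  "circuit_depth C = Max {d. \<exists>g\<in>gates C. \<exists>h\<in>gates C. (g, h) \<in> edges C ^^ d}"

definition FAC0 ::
    "('k::comm_semiring_1 \<Rightarrow> 'k \<Rightarrow> bool) \<Rightarrow> cmp set \<Rightarrow> ('k list \<Rightarrow> 'k) set" where
  "FAC0 le Ops = {f. \<exists>C :: nat \<Rightarrow> 'k circuit.
     (\<forall>n. arith_circuit Ops n (C n)) \<and>
     (\<exists>k::nat. (\<lambda>n. real (circuit_size (C n))) \<in> O(\<lambda>n. real n ^ k)) \<and>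
     (\<lambda>n. real (circuit_depth (C n))) \<in> O(\<lambda>_. 1) \<and>
     (\<forall>x. f x = circuit_fun le (C (length x)) x)}"

section \<open>First-order logic with semiring semantics\<close>

text \<open>
  A finite relational vocabulary is the list of the arities of its symbols; a symbol is its position
  in the list.
\<close>

type_synonym vocab = "nat list"

text \<open>
  \<open>Rel\<close> and \<open>NRel\<close> are the literals over \<open>\<tau>\<close>, \<open>Num\<close> and \<open>NNum\<close> those over \<open>\<sigma>\<close>. The formulas without \<open>Cmp\<close>
  are the ones called \<open>\<alpha>\<close> in the two-level grammar \<open>\<phi> ::= \<alpha> | \<alpha> \<circ> \<alpha> | \<phi> \<and> \<phi> | \<dots>\<close>. Here the operands of a
  comparison are arbitrary formulas, as in the semantic clause for \<open>\<phi> \<circ> \<psi>\<close>: comparison gates can be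
  nested, and comparisons of \<open>\<alpha>\<close>-formulas alone cannot simulate this. For example, with only \<open>=\<close> over
  the natural numbers, they do not define the function with value \<open>1\<close> if \<open>x \<noteq> y\<close> and \<open>0\<close> if \<open>x = y\<close>,
  which is \<open>(x = y) = 0\<close>.
\<close>

datatype formula =
    VEq nat nat
  | VNeq nat nat
  | Rel nat "nat list"
  | NRel nat "nat list"
  | Num nat "nat list"
  | NNum nat "nat list"
  | Cmp cmp formula formula
  | And formula formula
  | Or formula formula
  | Ex nat formula
  | All nat formula

fun fv :: "formula \<Rightarrow> nat set" where
  "fv (VEq x y) = {x, y}"
| "fv (VNeq x y) = {x, y}"
| "fv (Rel R xs) = set xs"
| "fv (NRel R xs) = set xs"
| "fv (Num P xs) = set xs"
| "fv (NNum P xs) = set xs"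
| "fv (Cmp oper \<phi> \<psi>) = fv \<phi> \<union> fv \<psi>"
| "fv (And \<phi> \<psi>) = fv \<phi> \<union> fv \<psi>"
| "fv (Or \<phi> \<psi>) = fv \<phi> \<union> fv \<psi>"
| "fv (Ex x \<phi>) = fv \<phi> - {x}"
| "fv (All x \<phi>) = fv \<phi> - {x}"

fun is_formula :: "cmp set \<Rightarrow> vocab \<Rightarrow> vocab \<Rightarrow> formula \<Rightarrow> bool" where
  "is_formula Ops \<tau> \<sigma> (VEq x y) \<longleftrightarrow> True"
| "is_formula Ops \<tau> \<sigma> (VNeq x y) \<longleftrightarrow> True"
| "is_formula Ops \<tau> \<sigma> (Rel R xs) \<longleftrightarrow> R < length \<tau> \<and> length xs = \<tau> ! R"
| "is_formula Ops \<tau> \<sigma> (NRel R xs) \<longleftrightarrow> R < length \<tau> \<and> length xs = \<tau> ! R"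
| "is_formula Ops \<tau> \<sigma> (Num P xs) \<longleftrightarrow> P < length \<sigma> \<and> length xs = \<sigma> ! P"
| "is_formula Ops \<tau> \<sigma> (NNum P xs) \<longleftrightarrow> P < length \<sigma> \<and> length xs = \<sigma> ! P"
| "is_formula Ops \<tau> \<sigma> (Cmp oper \<phi> \<psi>) \<longleftrightarrow>
     oper \<in> Ops \<and> is_formula Ops \<tau> \<sigma> \<phi> \<and> is_formula Ops \<tau> \<sigma> \<psi>"
| "is_formula Ops \<tau> \<sigma> (And \<phi> \<psi>) \<longleftrightarrow> is_formula Ops \<tau> \<sigma> \<phi> \<and> is_formula Ops \<tau> \<sigma> \<psi>"
| "is_formula Ops \<tau> \<sigma> (Or \<phi> \<psi>) \<longleftrightarrow> is_formula Ops \<tau> \<sigma> \<phi> \<and> is_formula Ops \<tau> \<sigma> \<psi>"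
| "is_formula Ops \<tau> \<sigma> (Ex x \<phi>) \<longleftrightarrow> is_formula Ops \<tau> \<sigma> \<phi>"
| "is_formula Ops \<tau> \<sigma> (All x \<phi>) \<longleftrightarrow> is_formula Ops \<tau> \<sigma> \<phi>"

definition is_sentence :: "cmp set \<Rightarrow> vocab \<Rightarrow> vocab \<Rightarrow> formula \<Rightarrow> bool" where
  "is_sentence Ops \<tau> \<sigma> \<phi> \<longleftrightarrow> is_formula Ops \<tau> \<sigma> \<phi> \<and> fv \<phi> = {}"

text \<open>
  The literals \<open>R(a)\<close> and \<open>\<not>R(a)\<close>. A \<open>K\<close>-interpretation is a function on literals; only its values on
  the literals over the universe and the vocabulary matter below.
\<close>

datatype 'a literal = Pos nat "'a list" | Neg nat "'a list"

text \<open>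
  A finite strictly ordered set is a finite nonempty subset \<open>A\<close> of a linearly ordered type.
\<close>

definition rank :: "'a::linorder set \<Rightarrow> 'a \<Rightarrow> nat" where
  "rank A a = card {b \<in> A. b \<le> a}"

fun sem :: "('k::comm_semiring_1 \<Rightarrow> 'k \<Rightarrow> bool) \<Rightarrow> 'a::linorder set \<Rightarrow>
    ('a literal \<Rightarrow> 'k) \<Rightarrow> (nat \<Rightarrow> nat literal \<Rightarrow> 'k) \<Rightarrow> (nat \<Rightarrow> 'a) \<Rightarrow> formula \<Rightarrow> 'k" where
  "sem le A \<pi> \<rho> s (VEq x y) = (if s x = s y then 1 else 0)"
| "sem le A \<pi> \<rho> s (VNeq x y) = (if s x \<noteq> s y then 1 else 0)"
| "sem le A \<pi> \<rho> s (Rel R xs) = \<pi> (Pos R (map s xs))"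
| "sem le A \<pi> \<rho> s (NRel R xs) = \<pi> (Neg R (map s xs))"
| "sem le A \<pi> \<rho> s (Num P xs) = \<rho> (card A) (Pos P (map (rank A) (map s xs)))"
| "sem le A \<pi> \<rho> s (NNum P xs) = \<rho> (card A) (Neg P (map (rank A) (map s xs)))"
| "sem le A \<pi> \<rho> s (Cmp oper \<phi> \<psi>) =
     (if cmp_holds le oper (sem le A \<pi> \<rho> s \<phi>) (sem le A \<pi> \<rho> s \<psi>) then 1 else 0)"
| "sem le A \<pi> \<rho> s (And \<phi> \<psi>) = sem le A \<pi> \<rho> s \<phi> * sem le A \<pi> \<rho> s \<psi>"
| "sem le A \<pi> \<rho> s (Or \<phi> \<psi>) = sem le A \<pi> \<rho> s \<phi> + sem le A \<pi> \<rho> s \<psi>"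
| "sem le A \<pi> \<rho> s (Ex x \<phi>) = (\<Sum>a\<in>A. sem le A \<pi> \<rho> (s(x := a)) \<phi>)"
| "sem le A \<pi> \<rho> s (All x \<phi>) = (\<Prod>a\<in>A. sem le A \<pi> \<rho> (s(x := a)) \<phi>)"

section \<open>Numerical predicates\<close>

definition tuples :: "nat \<Rightarrow> nat \<Rightarrow> nat list set" where
  "tuples n k = {xs. length xs = k \<and> set xs \<subseteq> {1..n}}"

definition Arb_arity :: "nat \<Rightarrow> (nat \<Rightarrow> nat list \<Rightarrow> 'k) set" where
  "Arb_arity k = {f. \<forall>n. f n \<in> tuples n k \<rightarrow>\<^sub>E UNIV}"

definition Arb :: "(nat \<Rightarrow> nat list \<Rightarrow> 'k) set" where
  "Arb = (\<Union>k. Arb_arity k)"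

definition admissible ::
    "(nat \<Rightarrow> nat list \<Rightarrow> 'k) set \<Rightarrow> vocab \<Rightarrow> (nat \<Rightarrow> nat literal \<Rightarrow> 'k) \<Rightarrow> bool" where
  "admissible F \<sigma> \<rho> \<longleftrightarrow> (\<forall>P < length \<sigma>. \<exists>f \<in> F \<inter> Arb_arity (\<sigma> ! P). \<exists>f' \<in> F \<inter> Arb_arity (\<sigma> ! P).
     \<forall>n. \<forall>as \<in> tuples n (\<sigma> ! P). \<rho> n (Pos P as) = f n as \<and> \<rho> n (Neg P as) = f' n as)"

section \<open>Encodings and evaluation functions\<close>

text \<open>
  The order of the literals: symbol by symbol, the positive literals before the negative ones, and
  argument tuples lexicographically. A symbol of arity \<open>0\<close> contributes \<open>card A\<close> copies of each of its
  two literals, so the length of the encoding determines \<open>card A\<close> unless \<open>\<tau>\<close> is empty.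
\<close>

definition arg_tuples :: "'a::linorder set \<Rightarrow> nat \<Rightarrow> 'a list list" where
  "arg_tuples A k = (if k = 0 then replicate (card A) []
     else product_lists (replicate k (sorted_list_of_set A)))"

definition literals :: "'a::linorder set \<Rightarrow> vocab \<Rightarrow> 'a literal list" where
  "literals A \<tau> = concat (map (\<lambda>R. map (Pos R) (arg_tuples A (\<tau> ! R)) @
                                   map (Neg R) (arg_tuples A (\<tau> ! R))) [0..<length \<tau>])"

definition enc :: "'a::linorder set \<Rightarrow> vocab \<Rightarrow> ('a literal \<Rightarrow> 'k) \<Rightarrow> 'k list" where
  "enc A \<tau> \<pi> = map \<pi> (literals A \<tau>)"

text \<open>
  \<open>EVAL\<close> is the graph of the function that maps \<open>enc A \<tau> \<pi>\<close> to the value of the sentence \<open>\<phi>\<close>; this value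
  does not depend on the assignment.
\<close>

definition EVAL :: "'a::linorder itself \<Rightarrow> ('k::comm_semiring_1 \<Rightarrow> 'k \<Rightarrow> bool) \<Rightarrow> vocab \<Rightarrow>
    (nat \<Rightarrow> nat literal \<Rightarrow> 'k) \<Rightarrow> formula \<Rightarrow> ('k list \<times> 'k) set" where
  "EVAL _ le \<tau> \<rho> \<phi> = {(enc A \<tau> \<pi>, sem le A \<pi> \<rho> (\<lambda>_. undefined) \<phi>) | (A :: 'a set) \<pi>.
     finite A \<and> A \<noteq> {}}"

definition FO :: "'a::linorder itself \<Rightarrow> ('k::comm_semiring_1 \<Rightarrow> 'k \<Rightarrow> bool) \<Rightarrow> cmp set \<Rightarrow>
    (nat \<Rightarrow> nat list \<Rightarrow> 'k) set \<Rightarrow> vocab \<Rightarrow> ('k list \<times> 'k) set set" where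
  "FO U le Ops F \<tau> = {EVAL U le \<tau> \<rho> \<phi> | \<sigma> \<rho> \<phi>. is_sentence Ops \<tau> \<sigma> \<phi> \<and> admissible F \<sigma> \<rho>}"

text \<open>
  The graph of \<open>f\<close>, restricted to the encodings of \<open>K\<close>-interpretations of \<open>\<tau>\<close>.
\<close>

definition on_encodings ::
    "'a::linorder itself \<Rightarrow> vocab \<Rightarrow> ('k list \<Rightarrow> 'k) \<Rightarrow> ('k list \<times> 'k) set" where
  "on_encodings _ \<tau> f = {(enc A \<tau> \<pi>, f (enc A \<tau> \<pi>)) | (A :: 'a set) \<pi>. finite A \<and> A \<noteq> {}}"

end

theory Submission
  imports Defs "HOL-Library.Countable"
begin

text \<open>
  A sentence over a universe with \<open>m\<close> elements unfolds to an expression tree whose depth is that of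
  the sentence and whose fan-in is at most \<open>max 2 m\<close>, hence to a circuit of constant depth and
  polynomial size. Numerical atoms become constant gates. As the length of an encoding determines
  \<open>m\<close>, this gives one circuit for each input length.

  Conversely, a circuit for an encoding over \<open>m\<close> elements has at most \<open>B * m ^ q\<close> gates, so its gates
  can be named by pairs of an index below \<open>B\<close> and a \<open>q\<close>-tuple over the universe. The factor \<open>B\<close> is
  necessary because of \<open>m = 1\<close>. Numerical predicates describe the labels and the edges of the
  circuits, and the values of the constant gates. By induction on \<open>d\<close>, the value at a gate of the
  circuit cut off at depth \<open>d\<close> is definable by a formula whose free variables name the gate.
\<close>

section \<open>Ranks and encodings\<close>

text \<open>Formulas can add and multiply, but they can neither distinguish cases nor subtract.
  Whatever concerns only the structure of a circuit is therefore put into numerical predicates with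
  values 0 and 1 that act as guards: a choice between cases becomes a sum of guarded terms, of which
  at most one is nonzero. In a product an absent factor has to count as 1, so the complement of the
  guard is supplied as a second numerical predicate. The universe is a subset of any linear order,
  while circuits and numerical predicates see only its size and ranks. All structure is thus
  computed over \<open>{1..m}\<close> and transferred along the bijection \<open>rank A\<close>. In
  the other direction the obstacle is the rigid notion of circuit: predecessors form sets, so equal
  subformulas need different gates, and connectedness forces every input to reach the output, even
  if the sentence never mentions it.\<close>

lemma rank_in:
  assumes "finite A" "a \<in> A"
  shows "rank A a \<in> {1..card A}"
proof -
  have "{b \<in> A. b \<le> a} \<noteq> {}" "finite {b \<in> A. b \<le> a}"
    using assms by auto
  moreover have "card {b \<in> A. b \<le> a} \<le> card A"
    using assms by (intro card_mono) auto
  ultimately show ?thesis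
    unfolding rank_def by (simp add: Suc_le_eq card_gt_0_iff)
qed

lemma rank_less:
  assumes "finite A" "b \<in> A" "a < b"
  shows "rank A a < rank A b"
  unfolding rank_def
proof (rule psubset_card_mono)
  have "b \<in> {c \<in> A. c \<le> b}" "b \<notin> {c \<in> A. c \<le> a}" "{c \<in> A. c \<le> a} \<subseteq> {c \<in> A. c \<le> b}"
    using assms by auto
  then show "{c \<in> A. c \<le> a} \<subset> {c \<in> A. c \<le> b}"
    by blast
qed (use assms in simp)

lemma rank_inj_on:
  assumes "finite A"
  shows "inj_on (rank A) A"
proof (rule inj_onI)
  fix a b assume "a \<in> A" "b \<in> A" "rank A a = rank A b"
  then show "a = b"
    using rank_less[OF assms, of a b] rank_less[OF assms, of b a] by (cases a b rule: linorder_cases) auto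
qed

lemma map_rank_inj:
  assumes "finite A" "set xs \<subseteq> A" "set ys \<subseteq> A"
  shows "map (rank A) xs = map (rank A) ys \<longleftrightarrow> xs = ys"
  using inj_on_map_eq_map[of "rank A" xs ys] rank_inj_on[OF assms(1)] assms(2,3)
  by (meson Un_least inj_on_subset)

lemma rank_image:
  assumes "finite A"
  shows "rank A ` A = {1..card A}"
proof (rule card_subset_eq)
  show "rank A ` A \<subseteq> {1..card A}"
    using rank_in[OF assms] by blast
  show "card (rank A ` A) = card {1..card A}"
    using card_image[OF rank_inj_on[OF assms]] by simp
qed simp

lemma map_rank_sorted_list_of_set:
  assumes "finite A"
  shows "map (rank A) (sorted_list_of_set A) = sorted_list_of_set {1..card A}"
proof (rule sorted_distinct_set_unique)
  let ?xs = "sorted_list_of_set A"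
  have "sorted_wrt (<) ?xs"
    by simp
  then have "sorted_wrt (\<lambda>x y. rank A x < rank A y) ?xs"
    by (rule sorted_wrt_mono_rel[rotated]) (use assms rank_less in auto)
  then show "sorted (map (rank A) ?xs)"
    by (auto simp: sorted_map intro: sorted_wrt_mono_rel[rotated])
  show "distinct (map (rank A) ?xs)"
    using rank_inj_on assms by (simp add: distinct_map)
  show "set (map (rank A) ?xs) = set (sorted_list_of_set {1..card A})"
    using assms rank_image[OF assms] by simp
qed auto

lemma product_lists_map:
  "product_lists (map (map f) xss) = map (map f) (product_lists xss)"
  by (induction xss) (auto simp: map_concat comp_def)

lemma arg_tuples_rank:
  assumes "finite A"
  shows "arg_tuples {1..card A} k = map (map (rank A)) (arg_tuples A k)"
  unfolding arg_tuples_def map_rank_sorted_list_of_set[OF assms, symmetric]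
  by (simp flip: product_lists_map)

text \<open>The rank is an order isomorphism, so it preserves lexicographic listings. Hence the
  position of a literal depends only on \<open>card A\<close> and the ranks of its
  arguments.\<close>

lemma literals_rank:
  assumes "finite A"
  shows "literals {1..card A} \<tau> = map (map_literal (rank A)) (literals A \<tau>)"
  unfolding literals_def
  by (simp add: arg_tuples_rank[OF assms, simplified] map_concat comp_def)

section \<open>Contents and length of the list of literals\<close>

lemma set_arg_tuples:
  assumes "finite A" "A \<noteq> {}"
  shows "set (arg_tuples A k) = {as. length as = k \<and> set as \<subseteq> A}"
proof (cases "k = 0")
  case True
  then show ?thesis
    using assms by (auto simp: arg_tuples_def)
next
  case False
  have "list_all2 (\<lambda>x ys. x \<in> set ys) xs (replicate k (sorted_list_of_set A)) \<longleftrightarrow>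
      length xs = k \<and> (\<forall>x\<in>set xs. x \<in> A)" for xs
    using assms by (auto simp: list_all2_conv_all_nth all_set_conv_all_nth)
  then show ?thesis
    using False by (auto simp: arg_tuples_def product_lists_set)
qed

lemma set_literals:
  assumes "finite A" "A \<noteq> {}"
  shows "set (literals A \<tau>) =
    {Pos R as | R as. R < length \<tau> \<and> length as = \<tau> ! R \<and> set as \<subseteq> A} \<union>
    {Neg R as | R as. R < length \<tau> \<and> length as = \<tau> ! R \<and> set as \<subseteq> A}"
  unfolding literals_def using set_arg_tuples[OF assms] by auto

text \<open>Positions below the length hold literals with arguments in \<open>A\<close>, where the
  rank is injective; so comparing literals over ranks loses nothing.\<close>

lemma literals_eq_rank_iff:
  assumes "finite A" "A \<noteq> {}" "i < length (literals A \<tau>)" "set as \<subseteq> A"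
  shows "literals {1..card A} \<tau> ! i = Pos R (map (rank A) as) \<longleftrightarrow> literals A \<tau> ! i = Pos R as"
    and "literals {1..card A} \<tau> ! i = Neg R (map (rank A) as) \<longleftrightarrow> literals A \<tau> ! i = Neg R as"
proof -
  have "literals A \<tau> ! i \<in> set (literals A \<tau>)"
    using assms by simp
  then show "literals {1..card A} \<tau> ! i = Pos R (map (rank A) as) \<longleftrightarrow> literals A \<tau> ! i = Pos R as"
    and "literals {1..card A} \<tau> ! i = Neg R (map (rank A) as) \<longleftrightarrow> literals A \<tau> ! i = Neg R as"
    unfolding set_literals[OF assms(1,2)] literals_rank[OF assms(1)]
    using assms map_rank_inj[OF assms(1)] by auto
qed

text \<open>The factor 2 counts positive and negative literals; \<open>max 1\<close> is the padding
  of nullary symbols to \<open>m\<close> copies.\<close>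

definition enc_length :: "vocab \<Rightarrow> nat \<Rightarrow> nat" where
  "enc_length \<tau> m = (\<Sum>k\<leftarrow>\<tau>. 2 * m ^ max 1 k)"

lemma length_product_lists_replicate:
  "length (product_lists (replicate k xs)) = length xs ^ k"
  by (induction k) (auto simp: length_concat comp_def sum_list_triv)

lemma length_literals:
  assumes "finite A"
  shows "length (literals A \<tau>) = enc_length \<tau> (card A)"
proof -
  have *: "length (arg_tuples A k) = card A ^ max 1 k" for k
    by (cases "k = 0") (auto simp: arg_tuples_def length_product_lists_replicate max_def)
  have "length (literals A \<tau>) = (\<Sum>R\<leftarrow>[0..<length \<tau>]. 2 * card A ^ max 1 (\<tau> ! R))"
    by (simp add: literals_def length_concat comp_def * mult_2)
  also have "\<dots> = sum_list (map (\<lambda>k. 2 * card A ^ max 1 k) (map ((!) \<tau>) [0..<length \<tau>]))"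
    by (simp only: map_map comp_def)
  finally show ?thesis
    by (simp only: map_nth enc_length_def)
qed

lemma length_enc:
  assumes "finite A"
  shows "length (enc A \<tau> \<pi>) = enc_length \<tau> (card A)"
  using assms by (simp add: enc_def length_literals)

lemma enc_length_ge:
  assumes "\<tau> \<noteq> []"
  shows "m \<le> enc_length \<tau> m"
proof -
  obtain k \<tau>' where \<tau>: "\<tau> = k # \<tau>'"
    using assms by (cases \<tau>) auto
  have "m \<le> m ^ max 1 k"
    by (cases "m = 0") (auto intro!: self_le_power)
  then show ?thesis
    by (simp add: \<tau> enc_length_def)
qed

text \<open>By the padding all exponents are at least 1, so every summand grows strictly with the
  universe, even for nullary symbols. This is what lets the input length determine the size of the
  universe.\<close>

lemma enc_length_strict_mono:
  assumes "\<tau> \<noteq> []" "m < m'"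
  shows "enc_length \<tau> m < enc_length \<tau> m'"
  unfolding enc_length_def
  by (rule sum_list_strict_mono) (use assms in \<open>auto intro!: power_strict_mono\<close>)

lemma enc_length_inj:
  assumes "\<tau> \<noteq> []" "enc_length \<tau> m = enc_length \<tau> m'"
  shows "m = m'"
  using enc_length_strict_mono[OF assms(1)] assms(2) by (metis linorder_neqE_nat nat_less_le)

text \<open>The exponent \<open>Suc (sum_list \<tau>)\<close> dominates every \<open>max 1 k\<close>
  at once.\<close>

lemma enc_length_le:
  assumes "m \<ge> 1"
  shows "enc_length \<tau> m \<le> 2 * length \<tau> * m ^ Suc (sum_list \<tau>)"
proof -
  have "2 * m ^ max 1 k \<le> 2 * m ^ Suc (sum_list \<tau>)" if "k \<in> set \<tau>" for k
    using assms member_le_sum_list[OF that] by (intro mult_left_mono power_increasing) auto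
  then have "enc_length \<tau> m \<le> (\<Sum>k\<leftarrow>\<tau>. 2 * m ^ Suc (sum_list \<tau>))"
    unfolding enc_length_def by (intro sum_list_mono)
  then show ?thesis
    by (simp add: sum_list_triv algebra_simps)
qed

section \<open>Evaluation of circuits\<close>

text \<open>One step of the recursion in \<open>gate_value\<close>, with the values of the
  predecessors as an argument, so that it serves both full evaluation and evaluation cut off at a
  depth.\<close>

fun label_value :: "('k::comm_semiring_1 \<Rightarrow> 'k \<Rightarrow> bool) \<Rightarrow> 'k list \<Rightarrow> 'k label \<Rightarrow> (nat \<Rightarrow> 'k) \<Rightarrow> 'k"
where
  "label_value le x (In i) v = x ! i"
| "label_value le x (Const c) v = c"
| "label_value le x (Plus S) v = (\<Sum>h\<in>S. v h)"
| "label_value le x (Times S) v = (\<Prod>h\<in>S. v h)"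
| "label_value le x (Compare oper a b) v = (if cmp_holds le oper (v a) (v b) then 1 else 0)"
| "label_value le x (Out a) v = v a"

lemma label_value_cong:
  assumes "\<And>h. h \<in> preds l \<Longrightarrow> v h = w h"
  shows "label_value le x l v = label_value le x l w"
  using assms by (cases l) auto

lemma arith_circuit_wf:
  assumes "arith_circuit Ops n C"
  shows "wf (edges C)"
  using assms unfolding arith_circuit_def
  by (meson finite_SigmaI finite_acyclic_wf finite_subset)

text \<open>\<open>wfrec\<close> hands to the step a function cut off to the predecessors of
  \<open>g\<close>; the step looks at nothing else, so the cut is harmless.\<close>

lemma gate_value_unfold:
  assumes C: "arith_circuit Ops n C" and g: "g \<in> gates C"
  shows "gate_value le C x g = label_value le x (label C g) (gate_value le C x)"
proof -
  let ?F = "\<lambda>v g. label_value le x (label C g) v"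
  have eq: "gate_value le C x = wfrec (edges C) ?F"
    unfolding gate_value_def by (intro arg_cong[of _ _ "wfrec _"] ext) (auto split: label.split)
  have "wfrec (edges C) ?F g = ?F (cut (wfrec (edges C) ?F) (edges C) g) g"
    by (rule wfrec[OF arith_circuit_wf[OF C]])
  also have "\<dots> = ?F (wfrec (edges C) ?F) g"
    by (rule label_value_cong) (use g in \<open>auto simp: cut_apply edges_def\<close>)
  finally show ?thesis
    unfolding eq .
qed

lemma circuit_depth_path:
  assumes C: "arith_circuit Ops n C" and "g \<in> gates C" "h \<in> gates C" "(h, g) \<in> edges C ^^ d"
  shows "d \<le> circuit_depth C"
proof -
  have E: "edges C \<subseteq> gates C \<times> gates C" and fin: "finite (gates C)"
    using C by (auto simp: arith_circuit_def)
  \<comment> \<open>\<open>circuit_depth\<close> is a \<open>Max\<close>, hence an upper bound only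
    once the set of path lengths is known to be finite.\<close>
  have "finite {d. \<exists>h. (h, g) \<in> edges C ^^ d}" for g
  proof (induction g rule: wf_induct_rule[OF arith_circuit_wf[OF C]])
    case (1 g)
    have sub: "{d. \<exists>h. (h, g) \<in> edges C ^^ d} \<subseteq>
        insert 0 (Suc ` (\<Union>g'\<in>{g'. (g', g) \<in> edges C}. {d. \<exists>h. (h, g') \<in> edges C ^^ d}))"
    proof
      fix d assume "d \<in> {d. \<exists>h. (h, g) \<in> edges C ^^ d}"
      then show "d \<in> insert 0 (Suc ` (\<Union>g'\<in>{g'. (g', g) \<in> edges C}. {d. \<exists>h. (h, g') \<in> edges C ^^ d}))"
        by (cases d) auto
    qed
    have "finite {g'. (g', g) \<in> edges C}"
      by (rule finite_subset[OF _ fin]) (use E in auto)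
    then show ?case
      by (intro finite_subset[OF sub]) (use 1 in auto)
  qed
  then have "finite (\<Union>g\<in>gates C. {d. \<exists>h. (h, g) \<in> edges C ^^ d})"
    using fin by auto
  then have "finite {d. \<exists>g\<in>gates C. \<exists>h\<in>gates C. (g, h) \<in> edges C ^^ d}"
    by (rule rev_finite_subset) auto
  then show ?thesis
    unfolding circuit_depth_def using assms by (intro Max_ge) auto
qed

section \<open>Evaluation cut off at a fixed depth\<close>

fun bounded_value ::
    "('k::comm_semiring_1 \<Rightarrow> 'k \<Rightarrow> bool) \<Rightarrow> 'k circuit \<Rightarrow> 'k list \<Rightarrow> nat \<Rightarrow> nat \<Rightarrow> 'k" where
  "bounded_value le C x 0 g = 0"
| "bounded_value le C x (Suc d) g = label_value le x (label C g) (bounded_value le C x d)"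

text \<open>If no path of length \<open>d\<close> ends in \<open>g\<close>, the recursion stops at
  gates without predecessors before it meets the default 0. For \<open>d = 0\<close> the empty path
  contradicts the hypothesis.\<close>

lemma bounded_value_eq:
  assumes C: "arith_circuit Ops n C" and "g \<in> gates C" "\<And>h. (h, g) \<notin> edges C ^^ d"
  shows "bounded_value le C x d g = gate_value le C x g"
  using assms(2,3)
proof (induction d arbitrary: g)
  case 0
  then show ?case by auto
next
  case (Suc d)
  have "bounded_value le C x d h = gate_value le C x h" if "h \<in> preds (label C g)" for h
  proof (rule Suc.IH)
    have "(h, g) \<in> edges C"
      using that Suc.prems(1) by (simp add: edges_def)
    then show "h \<in> gates C" "\<And>h'. (h', h) \<notin> edges C ^^ d"
      using C Suc.prems(2) by (auto simp: arith_circuit_def)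
  qed
  then have "bounded_value le C x (Suc d) g = label_value le x (label C g) (gate_value le C x)"
    by (auto intro: label_value_cong)
  then show ?case
    using gate_value_unfold[OF C Suc.prems(1)] by simp
qed

lemma circuit_fun_bounded_value:
  assumes C: "arith_circuit Ops n C" and "circuit_depth C < d"
  obtains g where "g \<in> gates C" "\<And>x. circuit_fun le C x = bounded_value le C x d g"
proof -
  let ?g = "THE g. g \<in> gates C \<and> is_Out (label C g)"
  have "\<exists>!g. g \<in> gates C \<and> is_Out (label C g)"
    using C by (simp add: arith_circuit_def)
  then have g: "?g \<in> gates C"
    by (metis (mono_tags, lifting) theI')
  have "(h, ?g) \<notin> edges C ^^ d" for h
  proof
    assume path: "(h, ?g) \<in> edges C ^^ d"
    \<comment> \<open>Depth counts only paths between gates. Since \<open>d > 0\<close>, the path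
      has a first edge, whose source is a gate.\<close>
    then obtain h' where "(h, h') \<in> edges C"
      using assms(2) by (metis gr0_conv_Suc less_nat_zero_code not_gr_zero relpow_Suc_E2)
    then have "h \<in> gates C"
      using C by (auto simp: arith_circuit_def)
    then show False
      using circuit_depth_path[OF C g _ path] assms(2) by simp
  qed
  then have "circuit_fun le C x = bounded_value le C x d ?g" for x
    unfolding circuit_fun_def using bounded_value_eq[OF C g, of d] by simp
  then show ?thesis
    by (rule that[OF g])
qed

section \<open>Circuits from expression trees\<close>

datatype 'k op = OIn nat | OConst 'k | OSum | OProd | OCmp cmp

datatype 'k tree = Nd "'k op" "'k tree list"

fun tree_val :: "('k::comm_semiring_1 \<Rightarrow> 'k \<Rightarrow> bool) \<Rightarrow> 'k list \<Rightarrow> 'k tree \<Rightarrow> 'k" where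
  "tree_val le x (Nd (OIn i) ts) = x ! i"
| "tree_val le x (Nd (OConst c) ts) = c"
| "tree_val le x (Nd OSum ts) = sum_list (map (tree_val le x) ts)"
| "tree_val le x (Nd OProd ts) = prod_list (map (tree_val le x) ts)"
| "tree_val le x (Nd (OCmp oper) ts) =
     (case map (tree_val le x) ts of [a, b] \<Rightarrow> if cmp_holds le oper a b then 1 else 0 | _ \<Rightarrow> 0)"

fun op_ok :: "cmp set \<Rightarrow> nat \<Rightarrow> 'k op \<Rightarrow> nat \<Rightarrow> bool" where
  "op_ok Ops n (OIn i) k \<longleftrightarrow> i < n \<and> k = 0"
| "op_ok Ops n (OConst c) k \<longleftrightarrow> k = 0"
| "op_ok Ops n (OCmp oper) k \<longleftrightarrow> oper \<in> Ops \<and> k = 2"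
| "op_ok Ops n _ k \<longleftrightarrow> True"

text \<open>\<open>W\<close> bounds the fan-in and \<open>D\<close> the height. As
  \<open>D - 1\<close> is truncated at 0, it is the condition \<open>0 < D\<close> at inner nodes
  that makes \<open>D\<close> a bound.\<close>

fun tree_ok :: "cmp set \<Rightarrow> nat \<Rightarrow> nat \<Rightarrow> nat \<Rightarrow> 'k tree \<Rightarrow> bool" where
  "tree_ok Ops n W D (Nd op ts) \<longleftrightarrow>
     op_ok Ops n op (length ts) \<and> length ts \<le> W \<and> (ts \<noteq> [] \<longrightarrow> 0 < D) \<and>
     (\<forall>t\<in>set ts. tree_ok Ops n W (D - 1) t)"

text \<open>Paths lead from the node up to the root, so that the children of \<open>p\<close> are the \<open>i # p\<close>.\<close>

fun subtree :: "'k tree \<Rightarrow> nat list \<Rightarrow> 'k tree option" where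
  "subtree t [] = Some t"
| "subtree t (i # p) = (case subtree t p of
     Some (Nd op ts) \<Rightarrow> if i < length ts then Some (ts ! i) else None
   | None \<Rightarrow> None)"

text \<open>The nodes of the tree are words of length at most \<open>D\<close> over \<open>W\<close>
  letters, which for fixed \<open>D\<close> makes their number polynomial in
  \<open>W\<close>.\<close>

lemma subtree_ok:
  assumes "tree_ok Ops n W D t" "subtree t p = Some u"
  shows "length p \<le> D \<and> set p \<subseteq> {..<W} \<and> tree_ok Ops n W (D - length p) u"
  using assms(2)
proof (induction p arbitrary: u)
  case Nil
  then show ?case
    using assms(1) by simp
next
  case (Cons i p)
  obtain op ts where p: "subtree t p = Some (Nd op ts)" "i < length ts" "u = ts ! i"
    using Cons.prems by (auto split: option.splits tree.splits if_splits)
  have "tree_ok Ops n W (D - length p) (Nd op ts)" and "set p \<subseteq> {..<W}"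
    using Cons.IH[OF p(1)] by auto
  then show ?case
    using p(2,3) by auto
qed

text \<open>Nodes are named by paths and not by subtrees: predecessors form a set, and the two equal
  children of a disjunction of a formula with itself must both be counted.\<close>

datatype gate = InG nat | NodeG "nat list" | OutG

instance gate :: countable
  by countable_datatype

abbreviation child :: "nat list \<Rightarrow> nat \<Rightarrow> nat" where
  "child p i \<equiv> to_nat (NodeG (i # p))"

text \<open>A leaf for an input is a unary sum, since each input has a single gate.\<close>

fun node_label :: "nat list \<Rightarrow> 'k tree \<Rightarrow> 'k label" where
  "node_label p (Nd (OIn i) ts) = Plus {to_nat (InG i)}"
| "node_label p (Nd (OConst c) ts) = Const c"
| "node_label p (Nd OSum ts) = Plus (child p ` {..<length ts})"
| "node_label p (Nd OProd ts) = Times (child p ` {..<length ts})"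
| "node_label p (Nd (OCmp oper) ts) = Compare oper (child p 0) (child p 1)"

definition tree_gates :: "nat \<Rightarrow> 'k tree \<Rightarrow> gate set" where
  "tree_gates n t = InG ` {..<n} \<union> NodeG ` {p. subtree t p \<noteq> None} \<union> {OutG}"

fun gate_label :: "'k tree \<Rightarrow> gate \<Rightarrow> 'k label" where
  "gate_label t (InG i) = In i"
| "gate_label t (NodeG p) = node_label p (the (subtree t p))"
| "gate_label t OutG = Out (to_nat (NodeG []))"

definition tree_circuit :: "nat \<Rightarrow> 'k tree \<Rightarrow> 'k circuit" where
  "tree_circuit n t =
     \<lparr>gates = to_nat ` tree_gates n t, label = \<lambda>g. gate_label t (from_nat g)\<rparr>"

section \<open>Size, depth, correctness and value of the circuit of a tree\<close>

context
  fixes Ops :: "cmp set" and n W D :: nat and t :: "'k::comm_semiring_1 tree"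
  assumes ok: "tree_ok Ops n W D t"
begin

text \<open>Increases strictly along edges, which gives acyclicity and the depth bound together.
  Paths have length at most \<open>D\<close>, so nodes lie in levels 1 to \<open>D + 1\<close>,
  between the input gates and the output gate.\<close>

fun level :: "gate \<Rightarrow> nat" where
  "level (InG i) = 0"
| "level (NodeG p) = Suc D - length p"
| "level OutG = D + 2"

text \<open>The arities demanded by \<open>op_ok\<close> ensure that the two operands of a
  comparison exist and that input indices are below \<open>n\<close>.\<close>

lemma node_preds:
  assumes p: "subtree t p = Some u" and h: "h \<in> preds (node_label p u)"
  obtains i where "h = to_nat (InG i)" "i < n"
    | i where "h = child p i" "subtree t (i # p) \<noteq> None"
proof -
  obtain op ts where u: "u = Nd op ts"
    by (cases u)
  have "op_ok Ops n op (length ts)"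
    using subtree_ok[OF ok p] u by auto
  then show ?thesis
    using p h u that by (cases op) (auto simp: numeral_2_eq_2)
qed

lemma tree_edge:
  assumes "(h, g) \<in> edges (tree_circuit n t)"
  obtains h' g' where "h = to_nat h'" "g = to_nat g'" "h' \<in> tree_gates n t" "g' \<in> tree_gates n t"
    "level h' < level g'" "h' \<noteq> OutG"
proof -
  obtain g' where g': "g' \<in> tree_gates n t" "g = to_nat g'" "h \<in> preds (gate_label t g')"
    using assms by (auto simp: edges_def tree_circuit_def)
  show ?thesis
  proof (cases g')
    case (InG i)
    then show ?thesis
      using g' by simp
  next
    case OutG
    then show ?thesis
      using g' that[of "NodeG []" g'] by (auto simp: tree_gates_def)
  next
    case (NodeG p)
    then obtain u where u: "subtree t p = Some u"
      using g'(1) by (auto simp: tree_gates_def)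
    have p: "length p \<le> D"
      using subtree_ok[OF ok u] by simp
    have h: "h \<in> preds (node_label p u)"
      using NodeG u g' by simp
    show ?thesis
    proof (rule node_preds[OF u h])
      fix i assume "h = to_nat (InG i)" "i < n"
      then show ?thesis
        using that[of "InG i" g'] g' NodeG p by (auto simp: tree_gates_def)
    next
      fix i assume i: "h = child p i" "subtree t (i # p) \<noteq> None"
      then show ?thesis
        using that[of "NodeG (i # p)" g'] g' NodeG p by (auto simp: tree_gates_def)
    qed
  qed
qed

lemma finite_tree_nodes: "finite {p. subtree t p \<noteq> None}"
  and card_tree_nodes: "card {p. subtree t p \<noteq> None} \<le> Suc D * Suc W ^ D"
proof -
  let ?P = "{p. set p \<subseteq> {..<W} \<and> length p \<le> D}"
  have sub: "{p. subtree t p \<noteq> None} \<subseteq> ?P"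
    using subtree_ok[OF ok] by blast
  have fin: "finite ?P"
    by (rule finite_lists_length_le) simp
  show "finite {p. subtree t p \<noteq> None}"
    using sub fin by (rule finite_subset)
  have "card {p. subtree t p \<noteq> None} \<le> card ?P"
    using fin sub by (rule card_mono)
  also have "\<dots> = (\<Sum>i\<le>D. W ^ i)"
    by (subst card_lists_length_le) auto
  also have "\<dots> \<le> (\<Sum>i\<le>D. Suc W ^ D)"
  proof (rule sum_mono)
    fix i assume "i \<in> {..D}"
    \<comment> \<open>Passing to \<open>Suc W\<close> makes the base at least 1, so that powers
      increase with the exponent even for \<open>W = 0\<close>.\<close>
    then have "W ^ i \<le> Suc W ^ i" "Suc W ^ i \<le> Suc W ^ D"
      by (auto intro!: power_mono power_increasing simp del: power_Suc)
    then show "W ^ i \<le> Suc W ^ D"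
      by linarith
  qed
  finally show "card {p. subtree t p \<noteq> None} \<le> Suc D * Suc W ^ D"
    by simp
qed

lemma finite_tree_gates: "finite (tree_gates n t)"
  using finite_tree_nodes by (simp add: tree_gates_def)

lemma tree_circuit_size: "circuit_size (tree_circuit n t) \<le> n + Suc D * Suc W ^ D + 1"
proof -
  have "circuit_size (tree_circuit n t) = card (tree_gates n t)"
    by (simp add: circuit_size_def tree_circuit_def card_image)
  also have "\<dots> \<le> card (InG ` {..<n}) + card (NodeG ` {p. subtree t p \<noteq> None}) + card {OutG}"
    unfolding tree_gates_def by (meson add_mono_thms_linordered_semiring(3) card_Un_le le_trans)
  also have "card (InG ` {..<n}) = n"
    by (simp add: card_image inj_on_def)
  also have "card (NodeG ` {p. subtree t p \<noteq> None}) = card {p. subtree t p \<noteq> None}"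
    by (simp add: card_image inj_on_def)
  finally show ?thesis
    using card_tree_nodes by simp
qed

lemma level_le: "level g \<le> D + 2"
  by (cases g) auto

lemma level_path:
  assumes "(h, g) \<in> edges (tree_circuit n t) ^^ d"
  shows "level (from_nat h) + d \<le> level (from_nat g)"
  using assms
proof (induction d arbitrary: g)
  case (Suc d)
  then obtain g' where g': "(h, g') \<in> edges (tree_circuit n t) ^^ d"
      "(g', g) \<in> edges (tree_circuit n t)"
    by auto
  have "level (from_nat g') < level (from_nat g)"
    by (rule tree_edge[OF g'(2)]) simp
  then show ?case
    using Suc.IH[OF g'(1)] by simp
qed simp

lemma tree_circuit_depth: "circuit_depth (tree_circuit n t) \<le> D + 2"
proof -
  let ?X = "{d. \<exists>g\<in>gates (tree_circuit n t). \<exists>h\<in>gates (tree_circuit n t).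
               (g, h) \<in> edges (tree_circuit n t) ^^ d}"
  have sub: "?X \<subseteq> {..D + 2}"
  proof
    fix d assume "d \<in> ?X"
    then obtain g h where "(g, h) \<in> edges (tree_circuit n t) ^^ d"
      by blast
    then show "d \<in> {..D + 2}"
      using level_path[of g h d] level_le[of "from_nat h"] by simp
  qed
  \<comment> \<open>The empty path at a gate shows that the maximum is taken over a nonempty
    set.\<close>
  have "0 \<in> ?X"
    by (auto simp: tree_circuit_def tree_gates_def)
  then have "?X \<noteq> {}"
    by (metis (no_types, lifting) emptyE)
  then have "Max ?X \<in> ?X"
    by (rule Max_in[OF finite_subset[OF sub finite_atMost]])
  then have "Max ?X \<in> {..D + 2}"
    using sub by (rule set_mp[rotated])
  then show ?thesis
    by (simp add: circuit_depth_def)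
qed

text \<open>Every child is a predecessor of its parent: \<open>op_ok\<close> allows no children
  below inputs and constants and exactly two below comparisons. So a path can be climbed up to the
  root.\<close>

lemma tree_circuit_node_connected:
  assumes "subtree t p \<noteq> None"
  shows "(to_nat (NodeG p), to_nat OutG) \<in> (edges (tree_circuit n t))\<^sup>*"
  using assms
proof (induction p)
  case Nil
  then show ?case
    by (auto simp: edges_def tree_circuit_def tree_gates_def)
next
  case (Cons i p)
  then obtain op ts where p: "subtree t p = Some (Nd op ts)" "i < length ts"
    by (auto split: option.splits tree.splits if_splits)
  have "op_ok Ops n op (length ts)"
    using subtree_ok[OF ok p(1)] by auto
  then have "child p i \<in> preds (node_label p (Nd op ts))"
    using p by (cases op) (auto simp: numeral_2_eq_2 less_Suc_eq)
  then have "(child p i, to_nat (NodeG p)) \<in> edges (tree_circuit n t)"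
    using p by (auto simp: edges_def tree_circuit_def tree_gates_def)
  then show ?case
    using Cons.IH p by (auto intro: converse_rtrancl_into_rtrancl)
qed

lemma node_label_not [simp]: "node_label p u \<noteq> In i" "\<not> is_Out (node_label p u)"
  by (cases "(p, u)" rule: node_label.cases; simp)+

text \<open>Every gate has a directed path to the output gate, so any two gates are connected
  through it. An input gate enters the tree only at a leaf reading it, whence
  \<open>occ\<close>.\<close>

lemma tree_circuit_arith:
  assumes occ: "\<And>i. i < n \<Longrightarrow> \<exists>p. subtree t p = Some (Nd (OIn i) [])"
  shows "arith_circuit Ops n (tree_circuit n t)"
proof -
  let ?C = "tree_circuit n t"
  let ?E = "edges ?C"
  have gates: "gates ?C = to_nat ` tree_gates n t"
    and label: "label ?C (to_nat g) = gate_label t g" for g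
    by (auto simp: tree_circuit_def)
  have E: "?E \<subseteq> gates ?C \<times> gates ?C"
    unfolding gates by (auto elim!: tree_edge)
  have "?E \<subseteq> measure (\<lambda>g. level (from_nat g))"
    by (auto elim!: tree_edge)
  then have acyc: "acyclic ?E"
    by (meson wf_acyclic wf_measure wf_subset)
  have conn: "(to_nat g, to_nat OutG) \<in> ?E\<^sup>*" if g: "g \<in> tree_gates n t" for g
  proof (cases g)
    case (InG i)
    then obtain p where p: "subtree t p = Some (Nd (OIn i) [])"
      using g occ by (auto simp: tree_gates_def)
    then have "(to_nat g, to_nat (NodeG p)) \<in> ?E"
      unfolding edges_def gates using InG label by (auto simp: tree_gates_def)
    then show ?thesis
      using tree_circuit_node_connected[of p] p by (auto intro: converse_rtrancl_into_rtrancl)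
  next
    case (NodeG p)
    then show ?thesis
      using g tree_circuit_node_connected by (auto simp: tree_gates_def)
  qed simp
  have connected: "(g, h) \<in> (?E \<union> ?E\<inverse>)\<^sup>*" if "g \<in> gates ?C" "h \<in> gates ?C" for g h
  proof -
    have "(g, to_nat OutG) \<in> ?E\<^sup>*" "(to_nat OutG, h) \<in> (?E\<inverse>)\<^sup>*"
      using that conn unfolding gates rtrancl_converse by auto
    then show ?thesis
      by (meson in_rtrancl_UnI rtrancl_trans)
  qed
  have "\<exists>!g. g \<in> gates ?C \<and> label ?C g = In i" if "i < n" for i
  proof
    show "to_nat (InG i) \<in> gates ?C \<and> label ?C (to_nat (InG i)) = In i"
      using that by (auto simp: gates label tree_gates_def)
    fix g assume "g \<in> gates ?C \<and> label ?C g = In i"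
    then obtain g' where "g = to_nat g'" "gate_label t g' = In i"
      by (auto simp: gates label)
    then show "g = to_nat (InG i)"
      by (cases g') auto
  qed
  moreover have "\<exists>!g. g \<in> gates ?C \<and> is_Out (label ?C g)"
  proof
    show "to_nat OutG \<in> gates ?C \<and> is_Out (label ?C (to_nat OutG))"
      by (auto simp: gates label tree_gates_def)
    fix g assume "g \<in> gates ?C \<and> is_Out (label ?C g)"
    then obtain g' where "g = to_nat g'" "is_Out (gate_label t g')"
      by (auto simp: gates label)
    then show "g = to_nat OutG"
      by (cases g') auto
  qed
  moreover have "i < n" if g: "g \<in> gates ?C" "label ?C g = In i" for g i
  proof -
    obtain g' where "g' \<in> tree_gates n t" "g = to_nat g'"
      using g(1) unfolding gates by blast
    then show ?thesis
      using g(2) by (cases g') (auto simp: tree_gates_def label)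
  qed
  moreover have "oper \<in> Ops" if g: "g \<in> gates ?C" "label ?C g = Compare oper a b" for g oper a b
  proof -
    obtain g' where g': "g' \<in> tree_gates n t" "gate_label t g' = Compare oper a b"
      using g by (auto simp: gates label)
    then obtain p op ts where "subtree t p = Some (Nd op ts)" "node_label p (Nd op ts) = Compare oper a b"
      by (cases g') (auto simp: tree_gates_def, metis tree.exhaust)
    then show ?thesis
      using subtree_ok[OF ok, of p "Nd op ts"] by (cases op) auto
  qed
  moreover have "\<not> is_Out (label ?C h)" if hg: "(h, g) \<in> ?E" for h g
  proof (rule tree_edge[OF hg])
    fix h' assume "h = to_nat h'" "h' \<noteq> OutG"
    then show ?thesis
      by (cases h') (auto simp: label)
  qed
  ultimately show ?thesis
    unfolding arith_circuit_def
    using finite_tree_gates gates E acyc connected by auto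
qed

lemma tree_circuit_value:
  assumes C: "arith_circuit Ops n (tree_circuit n t)"
    and p: "subtree t p = Some u"
  shows "gate_value le (tree_circuit n t) x (to_nat (NodeG p)) = tree_val le x u"
  using p
proof (induction u arbitrary: p)
  case (Nd op ts)
  let ?C = "tree_circuit n t"
  let ?v = "gate_value le ?C x"
  have op: "op_ok Ops n op (length ts)"
    using subtree_ok[OF ok Nd.prems] by auto
  have "?v (to_nat (NodeG p)) = label_value le x (label ?C (to_nat (NodeG p))) ?v"
    by (rule gate_value_unfold[OF C]) (use Nd.prems in \<open>simp add: tree_circuit_def tree_gates_def\<close>)
  then have val: "?v (to_nat (NodeG p)) = label_value le x (node_label p (Nd op ts)) ?v"
    using Nd.prems by (simp add: tree_circuit_def)
  have IH: "?v (child p i) = tree_val le x (ts ! i)" if "i < length ts" for i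
    using Nd.IH[of "ts ! i" "i # p"] that Nd.prems by simp
  \<comment> \<open>Distinct positions have distinct gates, so a sum or product over the set of
    predecessors counts repeated children as often as they occur in the list.\<close>
  have inj: "inj_on (child p) S" for S
    by (simp add: inj_on_def)
  show ?case
  proof (cases op)
    case (OIn i)
    then have "to_nat (InG i) \<in> gates ?C"
      using op by (auto simp: tree_circuit_def tree_gates_def)
    then have "?v (to_nat (InG i)) = x ! i"
      using gate_value_unfold[OF C, of "to_nat (InG i)" le x] by (simp add: tree_circuit_def)
    then show ?thesis
      using val OIn by simp
  next
    case (OConst c)
    then show ?thesis
      using val by simp
  next
    case OSum
    then show ?thesis
      using val IH by (simp add: sum.reindex[OF inj] sum_list_sum_nth atLeast0LessThan)
  next
    case OProd
    then show ?thesis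
      using val IH by (simp add: prod.reindex[OF inj] prod.list_conv_set_nth atLeast0LessThan)
  next
    case (OCmp oper)
    then obtain u v where "ts = [u, v]"
      using op by (auto simp: numeral_2_eq_2 length_Suc_conv)
    then show ?thesis
      using val IH[of 0] IH[of 1] OCmp by simp
  qed
qed

lemma tree_circuit_fun:
  assumes C: "arith_circuit Ops n (tree_circuit n t)"
  shows "circuit_fun le (tree_circuit n t) x = tree_val le x t"
proof -
  let ?C = "tree_circuit n t"
  have out: "to_nat OutG \<in> gates ?C" "is_Out (label ?C (to_nat OutG))"
    by (auto simp: tree_circuit_def tree_gates_def)
  moreover have "\<exists>!g. g \<in> gates ?C \<and> is_Out (label ?C g)"
    using C by (simp add: arith_circuit_def)
  ultimately have "(THE g. g \<in> gates ?C \<and> is_Out (label ?C g)) = to_nat OutG"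
    by blast
  then have "circuit_fun le ?C x = gate_value le ?C x (to_nat OutG)"
    by (simp add: circuit_fun_def)
  also have "\<dots> = gate_value le ?C x (to_nat (NodeG []))"
    using gate_value_unfold[OF C out(1), of le x] by (simp add: tree_circuit_def)
  finally show ?thesis
    using tree_circuit_value[OF C, of "[]"] by simp
qed

end

section \<open>From formulas to circuits\<close>

text \<open>A choice is needed because a nullary literal occupies several positions. Any of them
  will do, since an encoding holds the same value at all of them.\<close>

definition literal_index :: "vocab \<Rightarrow> nat \<Rightarrow> nat literal \<Rightarrow> nat" where
  "literal_index \<tau> m l =
     (SOME i. i < length (literals {1..m} \<tau>) \<and> literals {1..m} \<tau> ! i = l)"

text \<open>Variables hold ranks instead of elements of a universe, so for a closed formula the tree
  is determined by \<open>m\<close>, and with it by the input length.\<close>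

fun formula_tree :: "vocab \<Rightarrow> (nat \<Rightarrow> nat literal \<Rightarrow> 'k::comm_semiring_1) \<Rightarrow> nat \<Rightarrow> (nat \<Rightarrow> nat) \<Rightarrow>
    formula \<Rightarrow> 'k tree" where
  "formula_tree \<tau> \<rho> m s (VEq x y) = Nd (OConst (if s x = s y then 1 else 0)) []"
| "formula_tree \<tau> \<rho> m s (VNeq x y) = Nd (OConst (if s x \<noteq> s y then 1 else 0)) []"
| "formula_tree \<tau> \<rho> m s (Rel R xs) = Nd (OIn (literal_index \<tau> m (Pos R (map s xs)))) []"
| "formula_tree \<tau> \<rho> m s (NRel R xs) = Nd (OIn (literal_index \<tau> m (Neg R (map s xs)))) []"
| "formula_tree \<tau> \<rho> m s (Num P xs) = Nd (OConst (\<rho> m (Pos P (map s xs)))) []"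
| "formula_tree \<tau> \<rho> m s (NNum P xs) = Nd (OConst (\<rho> m (Neg P (map s xs)))) []"
| "formula_tree \<tau> \<rho> m s (Cmp oper \<phi> \<psi>) =
     Nd (OCmp oper) [formula_tree \<tau> \<rho> m s \<phi>, formula_tree \<tau> \<rho> m s \<psi>]"
| "formula_tree \<tau> \<rho> m s (And \<phi> \<psi>) =
     Nd OProd [formula_tree \<tau> \<rho> m s \<phi>, formula_tree \<tau> \<rho> m s \<psi>]"
| "formula_tree \<tau> \<rho> m s (Or \<phi> \<psi>) =
     Nd OSum [formula_tree \<tau> \<rho> m s \<phi>, formula_tree \<tau> \<rho> m s \<psi>]"
| "formula_tree \<tau> \<rho> m s (Ex x \<phi>) =
     Nd OSum (map (\<lambda>a. formula_tree \<tau> \<rho> m (s(x := a)) \<phi>) (sorted_list_of_set {1..m}))"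
| "formula_tree \<tau> \<rho> m s (All x \<phi>) =
     Nd OProd (map (\<lambda>a. formula_tree \<tau> \<rho> m (s(x := a)) \<phi>) (sorted_list_of_set {1..m}))"

fun formula_depth :: "formula \<Rightarrow> nat" where
  "formula_depth (Cmp oper \<phi> \<psi>) = Suc (max (formula_depth \<phi>) (formula_depth \<psi>))"
| "formula_depth (And \<phi> \<psi>) = Suc (max (formula_depth \<phi>) (formula_depth \<psi>))"
| "formula_depth (Or \<phi> \<psi>) = Suc (max (formula_depth \<phi>) (formula_depth \<psi>))"
| "formula_depth (Ex x \<phi>) = Suc (formula_depth \<phi>)"
| "formula_depth (All x \<phi>) = Suc (formula_depth \<phi>)"
| "formula_depth _ = 0"

lemma literal_index:
  assumes "m \<ge> 1" "R < length \<tau>" "length as = \<tau> ! R" "set as \<subseteq> {1..m}" "l = Pos R as \<or> l = Neg R as"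
  shows "literal_index \<tau> m l < enc_length \<tau> m" "literals {1..m} \<tau> ! literal_index \<tau> m l = l"
proof -
  have "l \<in> set (literals {1..m} \<tau>)"
    using assms by (subst set_literals) auto
  then have "\<exists>i. i < length (literals {1..m} \<tau>) \<and> literals {1..m} \<tau> ! i = l"
    by (simp add: in_set_conv_nth)
  then have "literal_index \<tau> m l < length (literals {1..m} \<tau>) \<and>
      literals {1..m} \<tau> ! literal_index \<tau> m l = l"
    unfolding literal_index_def by (rule someI_ex)
  then show "literal_index \<tau> m l < enc_length \<tau> m" "literals {1..m} \<tau> ! literal_index \<tau> m l = l"
    by (auto simp: length_literals)
qed

text \<open>The fan-in 2 comes from the binary connectives, the fan-in \<open>m\<close> from the
  quantifiers.\<close>

lemma formula_tree_ok:
  assumes "m \<ge> 1" "2 \<le> W" "m \<le> W"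
  shows "is_formula Ops \<tau> \<sigma> \<phi> \<Longrightarrow> \<forall>x\<in>fv \<phi>. s x \<in> {1..m} \<Longrightarrow> formula_depth \<phi> \<le> D \<Longrightarrow>
    tree_ok Ops (enc_length \<tau> m) W D (formula_tree \<tau> \<rho> m s \<phi>)"
proof (induction \<phi> arbitrary: s D)
  case (Rel R xs)
  then show ?case
    using literal_index(1)[OF assms(1), of R \<tau> "map s xs"] by (simp add: image_subset_iff)
next
  case (NRel R xs)
  then show ?case
    using literal_index(1)[OF assms(1), of R \<tau> "map s xs"] by (simp add: image_subset_iff)
next
  case (Ex x \<phi>)
  have "tree_ok Ops (enc_length \<tau> m) W (D - 1) (formula_tree \<tau> \<rho> m (s(x := a)) \<phi>)" if "a \<in> {1..m}" for a
    by (rule Ex.IH) (use Ex.prems that in auto)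
  then show ?case
    using Ex.prems assms by auto
next
  case (All x \<phi>)
  have "tree_ok Ops (enc_length \<tau> m) W (D - 1) (formula_tree \<tau> \<rho> m (s(x := a)) \<phi>)" if "a \<in> {1..m}" for a
    by (rule All.IH) (use All.prems that in auto)
  then show ?case
    using All.prems assms by auto
qed (use assms in auto)

text \<open>The index is found in the list over ranks but applied to an encoding over
  \<open>A\<close>; \<open>literals_eq_rank_iff\<close> relates the two.\<close>

lemma enc_literal_index:
  fixes A :: "'a::linorder set"
  assumes A: "finite A" "A \<noteq> {}" and "R < length \<tau>" "length as = \<tau> ! R" "set as \<subseteq> A"
  shows "enc A \<tau> \<pi> ! literal_index \<tau> (card A) (Pos R (map (rank A) as)) = \<pi> (Pos R as)"
    and "enc A \<tau> \<pi> ! literal_index \<tau> (card A) (Neg R (map (rank A) as)) = \<pi> (Neg R as)"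
proof -
  have card: "card A \<ge> 1"
    using A by (simp add: Suc_le_eq card_gt_0_iff)
  have ranks: "set (map (rank A) as) \<subseteq> {1..card A}"
    using assms rank_in[OF A(1)] by auto
  have eq: "enc A \<tau> \<pi> ! i = \<pi> (literals A \<tau> ! i)" if "i < enc_length \<tau> (card A)" for i
    using that by (simp add: enc_def length_literals A)
  note pos = literal_index[OF card assms(3), of "map (rank A) as" "Pos R (map (rank A) as)"]
  note neg = literal_index[OF card assms(3), of "map (rank A) as" "Neg R (map (rank A) as)"]
  show "enc A \<tau> \<pi> ! literal_index \<tau> (card A) (Pos R (map (rank A) as)) = \<pi> (Pos R as)"
    using pos ranks assms eq literals_eq_rank_iff(1)[OF A _ assms(5)]
    by (auto simp: length_literals)
  show "enc A \<tau> \<pi> ! literal_index \<tau> (card A) (Neg R (map (rank A) as)) = \<pi> (Neg R as)"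
    using neg ranks assms eq literals_eq_rank_iff(2)[OF A _ assms(5)]
    by (auto simp: length_literals)
qed

lemma sum_list_ranks:
  fixes f :: "nat \<Rightarrow> 'k::comm_monoid_add"
  assumes "finite A"
  shows "sum_list (map f (sorted_list_of_set {1..card A})) = (\<Sum>a\<in>A. f (rank A a))"
  using assms sum.distinct_set_conv_list[of "sorted_list_of_set A" "f \<circ> rank A"]
  unfolding map_rank_sorted_list_of_set[OF assms, symmetric] by (simp add: comp_def)

lemma prod_list_ranks:
  fixes f :: "nat \<Rightarrow> 'k::comm_monoid_mult"
  assumes "finite A"
  shows "prod_list (map f (sorted_list_of_set {1..card A})) = (\<Prod>a\<in>A. f (rank A a))"
  using assms prod.distinct_set_conv_list[of "sorted_list_of_set A" "f \<circ> rank A"]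
  unfolding map_rank_sorted_list_of_set[OF assms, symmetric] by (simp add: comp_def)

text \<open>The assignment \<open>t\<close> is \<open>s\<close> read through ranks. Injectivity of
  the rank handles the equality atoms, and its bijectivity onto \<open>{1..card A}\<close> reindexes
  the quantifiers.\<close>

lemma formula_tree_val:
  fixes A :: "'a::linorder set"
  assumes A: "finite A" "A \<noteq> {}"
  shows "is_formula Ops \<tau> \<sigma> \<phi> \<Longrightarrow> \<forall>x\<in>fv \<phi>. s x \<in> A \<and> t x = rank A (s x) \<Longrightarrow>
    tree_val le (enc A \<tau> \<pi>) (formula_tree \<tau> \<rho> (card A) t \<phi>) = sem le A \<pi> \<rho> s \<phi>"
proof (induction \<phi> arbitrary: s t)
  case (VEq x y)
  then show ?case
    using inj_onD[OF rank_inj_on[OF A(1)]] by auto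
next
  case (VNeq x y)
  then show ?case
    using inj_onD[OF rank_inj_on[OF A(1)]] by auto
next
  case (Rel R xs)
  then have "map t xs = map (rank A) (map s xs)"
    by auto
  moreover have "enc A \<tau> \<pi> ! literal_index \<tau> (card A) (Pos R (map (rank A) (map s xs))) =
      \<pi> (Pos R (map s xs))"
    by (rule enc_literal_index[OF A]) (use Rel in auto)
  ultimately show ?case
    by (simp only: formula_tree.simps tree_val.simps sem.simps)
next
  case (NRel R xs)
  then have "map t xs = map (rank A) (map s xs)"
    by auto
  moreover have "enc A \<tau> \<pi> ! literal_index \<tau> (card A) (Neg R (map (rank A) (map s xs))) =
      \<pi> (Neg R (map s xs))"
    by (rule enc_literal_index[OF A]) (use NRel in auto)
  ultimately show ?case
    by (simp only: formula_tree.simps tree_val.simps sem.simps)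
next
  case (Num P xs)
  then have "map t xs = map (rank A) (map s xs)"
    by auto
  then show ?case
    by (simp only: formula_tree.simps tree_val.simps sem.simps)
next
  case (NNum P xs)
  then have "map t xs = map (rank A) (map s xs)"
    by auto
  then show ?case
    by (simp only: formula_tree.simps tree_val.simps sem.simps)
next
  case (Ex x \<phi>)
  have "tree_val le (enc A \<tau> \<pi>) (formula_tree \<tau> \<rho> (card A) (t(x := rank A a)) \<phi>) =
      sem le A \<pi> \<rho> (s(x := a)) \<phi>" if "a \<in> A" for a
    by (rule Ex.IH) (use Ex.prems that in auto)
  then show ?case
    by (simp add: comp_def sum_list_ranks[OF A(1), simplified])
next
  case (All x \<phi>)
  have "tree_val le (enc A \<tau> \<pi>) (formula_tree \<tau> \<rho> (card A) (t(x := rank A a)) \<phi>) =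
      sem le A \<pi> \<rho> (s(x := a)) \<phi>" if "a \<in> A" for a
    by (rule All.IH) (use All.prems that in auto)
  then show ?case
    by (simp add: comp_def prod_list_ranks[OF A(1), simplified])
next
  case (Cmp oper \<phi> \<psi>)
  have "tree_val le (enc A \<tau> \<pi>) (formula_tree \<tau> \<rho> (card A) t \<phi>) = sem le A \<pi> \<rho> s \<phi>"
    by (rule Cmp.IH(1)) (use Cmp.prems in auto)
  moreover have "tree_val le (enc A \<tau> \<pi>) (formula_tree \<tau> \<rho> (card A) t \<psi>) = sem le A \<pi> \<rho> s \<psi>"
    by (rule Cmp.IH(2)) (use Cmp.prems in auto)
  ultimately show ?case
    by simp
next
  case (And \<phi> \<psi>)
  have "tree_val le (enc A \<tau> \<pi>) (formula_tree \<tau> \<rho> (card A) t \<phi>) = sem le A \<pi> \<rho> s \<phi>"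
    by (rule And.IH(1)) (use And.prems in auto)
  moreover have "tree_val le (enc A \<tau> \<pi>) (formula_tree \<tau> \<rho> (card A) t \<psi>) = sem le A \<pi> \<rho> s \<psi>"
    by (rule And.IH(2)) (use And.prems in auto)
  ultimately show ?case
    by simp
next
  case (Or \<phi> \<psi>)
  have "tree_val le (enc A \<tau> \<pi>) (formula_tree \<tau> \<rho> (card A) t \<phi>) = sem le A \<pi> \<rho> s \<phi>"
    by (rule Or.IH(1)) (use Or.prems in auto)
  moreover have "tree_val le (enc A \<tau> \<pi>) (formula_tree \<tau> \<rho> (card A) t \<psi>) = sem le A \<pi> \<rho> s \<psi>"
    by (rule Or.IH(2)) (use Or.prems in auto)
  ultimately show ?case
    by simp
qed

text \<open>The second summand is \<open>0\<close>; it only serves to connect every input gate to the circuit.\<close>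

definition full_tree :: "nat \<Rightarrow> 'k::comm_semiring_1 tree \<Rightarrow> 'k tree" where
  "full_tree n t =
     Nd OSum [t, Nd OProd (Nd (OConst 0) [] # map (\<lambda>i. Nd (OIn i) []) [0..<n])]"

lemma tree_val_full_tree: "tree_val le x (full_tree n t) = tree_val le x t"
  by (simp add: full_tree_def)

text \<open>The added product has \<open>Suc n\<close> factors and is an inner node one level below
  the new root, which explains the bounds on \<open>W\<close> and \<open>D\<close>.\<close>

lemma full_tree_ok:
  assumes "tree_ok Ops n W D t" "Suc n \<le> W" "2 \<le> W" "1 \<le> D"
  shows "tree_ok Ops n W (Suc D) (full_tree n t)"
  using assms by (auto simp: full_tree_def)

lemma full_tree_circuit:
  assumes "tree_ok Ops n W D (full_tree n t)"
  shows "arith_circuit Ops n (tree_circuit n (full_tree n t))"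
proof (rule tree_circuit_arith[OF assms])
  fix i assume "i < n"
  \<comment> \<open>Read from the right: child 1 of the root is the added product, and the constant
    0 at its position 0 shifts input \<open>i\<close> to \<open>Suc i\<close>.\<close>
  then have "subtree (full_tree n t) [Suc i, 1] = Some (Nd (OIn i) [])"
    by (simp add: full_tree_def)
  then show "\<exists>p. subtree (full_tree n t) p = Some (Nd (OIn i) [])" ..
qed

text \<open>The left side is the bound of \<open>tree_circuit_size\<close> for fan-in
  \<open>n + 2\<close>; from \<open>n \<ge> 3\<close> follows
  \<open>n + 3 \<le> 2 * n\<close>.\<close>

lemma polynomial_size_bound:
  assumes "n \<ge> 3"
  shows "n + Suc D * Suc (n + 2) ^ D + 1 \<le> (Suc D * 2 ^ D + 2) * n ^ Suc D"
proof -
  have "Suc (n + 2) ^ D \<le> (2 * n) ^ D"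
    using assms by (intro power_mono) auto
  also have "\<dots> \<le> 2 ^ D * n ^ Suc D"
    using assms by (simp add: power_mult_distrib)
  finally have "Suc D * Suc (n + 2) ^ D \<le> Suc D * 2 ^ D * n ^ Suc D"
    by (simp only: mult.assoc mult_le_mono2)
  moreover have "1 \<le> n ^ D"
    using assms by simp
  then have "n \<le> n ^ Suc D"
    by simp
  moreover have "1 \<le> n ^ Suc D"
    using assms by simp
  ultimately show ?thesis
    by (simp only: add_mult_distrib)
qed

section \<open>The circuit family of a sentence\<close>

lemma Collect_eq_image_Times: "{f a b |a b. P a} = (\<lambda>(a, b). f a b) ` ({a. P a} \<times> UNIV)"
proof (rule subset_antisym)
  show "{f a b |a b. P a} \<subseteq> (\<lambda>(a, b). f a b) ` ({a. P a} \<times> UNIV)"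
  proof
    fix x assume "x \<in> {f a b |a b. P a}"
    then obtain a b where "x = f a b" "P a"
      by blast
    then show "x \<in> (\<lambda>(a, b). f a b) ` ({a. P a} \<times> UNIV)"
      by (intro image_eqI[of _ _ "(a, b)"]) auto
  qed
qed auto

lemma EVAL_eqI:
  fixes f :: "'k::comm_semiring_1 list \<Rightarrow> 'k"
  assumes eq: "\<And>(A :: 'a::linorder set) \<pi>. finite A \<Longrightarrow> A \<noteq> {} \<Longrightarrow>
    f (enc A \<tau> \<pi>) = sem le A \<pi> \<rho> (\<lambda>_. undefined) \<phi>"
  shows "EVAL TYPE('a) le \<tau> \<rho> \<phi> = on_encodings TYPE('a) \<tau> f"
proof -
  let ?S = "{A :: 'a set. finite A \<and> A \<noteq> {}} \<times> (UNIV :: ('a literal \<Rightarrow> 'k) set)"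
  have "EVAL TYPE('a) le \<tau> \<rho> \<phi> =
      (\<lambda>(A, \<pi>). (enc A \<tau> \<pi>, sem le A \<pi> \<rho> (\<lambda>_. undefined) \<phi>)) ` ?S"
    unfolding EVAL_def by (rule Collect_eq_image_Times)
  also have "\<dots> = (\<lambda>(A, \<pi>). (enc A \<tau> \<pi>, f (enc A \<tau> \<pi>))) ` ?S"
  proof (rule image_cong)
    fix p assume "p \<in> ?S"
    then show "(\<lambda>(A, \<pi>). (enc A \<tau> \<pi>, sem le A \<pi> \<rho> (\<lambda>_. undefined) \<phi>)) p =
        (\<lambda>(A, \<pi>). (enc A \<tau> \<pi>, f (enc A \<tau> \<pi>))) p"
      by (cases p) (simp add: eq)
  qed simp
  also have "\<dots> = on_encodings TYPE('a) \<tau> f"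
    unfolding on_encodings_def by (rule Collect_eq_image_Times[symmetric])
  finally show ?thesis .
qed

lemma EVAL_eq_on_encodings:
  fixes le :: "'k::comm_semiring_1 \<Rightarrow> 'k \<Rightarrow> bool"
  assumes "\<tau> \<noteq> []" and \<phi>: "is_sentence Ops \<tau> \<sigma> \<phi>"
  shows "\<exists>f\<in>FAC0 le Ops. EVAL TYPE('a::linorder) le \<tau> \<rho> \<phi> = on_encodings TYPE('a) \<tau> f"
proof -
  \<comment> \<open>One level above the formula keeps the height positive, as
    \<open>full_tree_ok\<close> requires; the other is the root added by
    \<open>full_tree\<close>.\<close>
  define D where "D = Suc (Suc (formula_depth \<phi>))"
  \<comment> \<open>Lengths that encode no nonempty universe get the constant 0;
    \<open>on_encodings\<close> never looks at them.\<close>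
  define t :: "nat \<Rightarrow> 'k tree" where "t n =
    (if \<exists>m\<ge>1. enc_length \<tau> m = n
     then formula_tree \<tau> \<rho> (THE m. enc_length \<tau> m = n) (\<lambda>_. undefined) \<phi> else Nd (OConst 0) [])" for n
  define C where "C n = tree_circuit n (full_tree n (t n))" for n
  have the: "(THE m'. enc_length \<tau> m' = enc_length \<tau> m) = m" for m
    using enc_length_inj[OF assms(1)] by blast
  \<comment> \<open>The fan-in \<open>n + 2\<close> covers the binary connectives, the quantifiers
    because of \<open>m \<le> n\<close>, and the \<open>n + 1\<close> factors of the added
    product.\<close>
  have t_ok: "tree_ok Ops n (n + 2) (Suc (formula_depth \<phi>)) (t n)" for n
  proof (cases "\<exists>m\<ge>1. enc_length \<tau> m = n")
    case True
    then obtain m where m: "m \<ge> 1" "n = enc_length \<tau> m"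
      by blast
    show ?thesis
      unfolding t_def m the
      using \<phi> m(1) enc_length_ge[OF assms(1), of m]
      by (auto simp: is_sentence_def simp del: tree_ok.simps intro!: formula_tree_ok)
  qed (auto simp: t_def)
  have ok: "tree_ok Ops n (n + 2) D (full_tree n (t n))" for n
    unfolding D_def by (intro full_tree_ok t_ok) auto
  have arith: "arith_circuit Ops n (C n)" for n
    unfolding C_def by (rule full_tree_circuit[OF ok])
  have "circuit_size (C n) \<le> (Suc D * 2 ^ D + 2) * n ^ Suc D" if "n \<ge> 3" for n
    using tree_circuit_size[OF ok, of n] polynomial_size_bound[OF that, of D]
    unfolding C_def by linarith
  then have "real (circuit_size (C n)) \<le> real (Suc D * 2 ^ D + 2) * real n ^ Suc D" if "n \<ge> 3" for n
    using that by (metis of_nat_le_iff of_nat_mult of_nat_power)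
  then have size: "(\<lambda>n. real (circuit_size (C n))) \<in> O(\<lambda>n. real n ^ Suc D)"
    by (intro bigoI[of _ "real (Suc D * 2 ^ D + 2)"] eventually_at_top_linorderI[of 3])
      (simp del: power_Suc)
  have "circuit_depth (C n) \<le> D + 2" for n
    unfolding C_def by (rule tree_circuit_depth[OF ok])
  then have depth: "(\<lambda>n. real (circuit_depth (C n))) \<in> O(\<lambda>_. 1)"
    by (intro bigoI[of _ "real (D + 2)"] always_eventually) (simp flip: of_nat_Suc)
  define f where "f x = circuit_fun le (C (length x)) x" for x
  have "f \<in> FAC0 le Ops"
    unfolding FAC0_def using arith size depth f_def by blast
  moreover have "f (enc A \<tau> \<pi>) = sem le A \<pi> \<rho> (\<lambda>_. undefined) \<phi>"
    if A: "finite A" "A \<noteq> {}" for A :: "'a set" and \<pi>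
  proof -
    have "card A \<ge> 1"
      using A by (simp add: Suc_le_eq card_gt_0_iff)
    then have t: "t (enc_length \<tau> (card A)) = formula_tree \<tau> \<rho> (card A) (\<lambda>_. undefined) \<phi>"
      unfolding t_def the by auto
    have "f (enc A \<tau> \<pi>) = tree_val le (enc A \<tau> \<pi>) (t (enc_length \<tau> (card A)))"
      using tree_circuit_fun[OF ok arith[unfolded C_def]] A(1)
      by (simp add: f_def C_def length_enc tree_val_full_tree)
    then show ?thesis
      unfolding t using \<phi> formula_tree_val[OF A, of Ops \<tau> \<sigma> \<phi>] by (simp add: is_sentence_def)
  qed
  then have "EVAL TYPE('a) le \<tau> \<rho> \<phi> = on_encodings TYPE('a) \<tau> f"
    by (rule EVAL_eqI)
  ultimately show ?thesis
    by blast
qed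

section \<open>Closure properties of definable functions\<close>

text \<open>
  Free variables are de Bruijn levels: the value depends on the list of the values of the variables
  \<open>0, \<dots>, n - 1\<close>, and a quantifier binds the variable \<open>n\<close>.
\<close>

definition expresses :: "('k::comm_semiring_1 \<Rightarrow> 'k \<Rightarrow> bool) \<Rightarrow> cmp set \<Rightarrow> vocab \<Rightarrow> vocab \<Rightarrow>
    (nat \<Rightarrow> nat literal \<Rightarrow> 'k) \<Rightarrow> nat \<Rightarrow> formula \<Rightarrow>
    ('a::linorder set \<Rightarrow> ('a literal \<Rightarrow> 'k) \<Rightarrow> 'a list \<Rightarrow> 'k) \<Rightarrow> bool" where
  "expresses le Ops \<tau> \<sigma> \<rho> n \<phi> h \<longleftrightarrow> is_formula Ops \<tau> \<sigma> \<phi> \<and> fv \<phi> \<subseteq> {..<n} \<and>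
     (\<forall>A \<pi> s. finite A \<longrightarrow> A \<noteq> {} \<longrightarrow> s ` {..<n} \<subseteq> A \<longrightarrow>
        sem le A \<pi> \<rho> s \<phi> = h A \<pi> (map s [0..<n]))"

text \<open>Each function may bring its own numerical predicates, but these are chosen before
  \<open>A\<close>, \<open>\<pi>\<close> and the arguments, so they can depend on the universe only
  through its size and ranks.\<close>

definition definable :: "('k::comm_semiring_1 \<Rightarrow> 'k \<Rightarrow> bool) \<Rightarrow> cmp set \<Rightarrow> vocab \<Rightarrow> nat \<Rightarrow>
    ('a::linorder set \<Rightarrow> ('a literal \<Rightarrow> 'k) \<Rightarrow> 'a list \<Rightarrow> 'k) \<Rightarrow> bool" where
  "definable le Ops \<tau> n h \<longleftrightarrow> (\<exists>\<sigma> \<rho> \<phi>. admissible Arb \<sigma> \<rho> \<and> expresses le Ops \<tau> \<sigma> \<rho> n \<phi> h)"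

section \<open>Merging numerical vocabularies; connectives, atoms and quantifiers\<close>

fun map_num :: "(nat \<Rightarrow> nat) \<Rightarrow> formula \<Rightarrow> formula" where
  "map_num r (Num P xs) = Num (r P) xs"
| "map_num r (NNum P xs) = NNum (r P) xs"
| "map_num r (Cmp oper \<phi> \<psi>) = Cmp oper (map_num r \<phi>) (map_num r \<psi>)"
| "map_num r (And \<phi> \<psi>) = And (map_num r \<phi>) (map_num r \<psi>)"
| "map_num r (Or \<phi> \<psi>) = Or (map_num r \<phi>) (map_num r \<psi>)"
| "map_num r (Ex x \<phi>) = Ex x (map_num r \<phi>)"
| "map_num r (All x \<phi>) = All x (map_num r \<phi>)"
| "map_num r \<phi> = \<phi>"

lemma fv_map_num: "fv (map_num r \<phi>) = fv \<phi>"
  by (induction \<phi>) auto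

lemma is_formula_map_num:
  assumes "is_formula Ops \<tau> \<sigma> \<phi>" "\<And>P. P < length \<sigma> \<Longrightarrow> r P < length \<sigma>' \<and> \<sigma>' ! r P = \<sigma> ! P"
  shows "is_formula Ops \<tau> \<sigma>' (map_num r \<phi>)"
  using assms by (induction \<phi>) auto

lemma sem_map_num:
  assumes "is_formula Ops \<tau> \<sigma> \<phi>"
    and "\<And>P n as. P < length \<sigma> \<Longrightarrow>
      \<rho>' n (Pos (r P) as) = \<rho> n (Pos P as) \<and> \<rho>' n (Neg (r P) as) = \<rho> n (Neg P as)"
  shows "sem le A \<pi> \<rho>' s (map_num r \<phi>) = sem le A \<pi> \<rho> s \<phi>"
  using assms by (induction \<phi> arbitrary: s) auto

lemma expresses_map_num:
  assumes "expresses le Ops \<tau> \<sigma> \<rho> n \<phi> h"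
    and "\<And>P. P < length \<sigma> \<Longrightarrow> r P < length \<sigma>' \<and> \<sigma>' ! r P = \<sigma> ! P"
    and "\<And>P n as. P < length \<sigma> \<Longrightarrow>
      \<rho>' n (Pos (r P) as) = \<rho> n (Pos P as) \<and> \<rho>' n (Neg (r P) as) = \<rho> n (Neg P as)"
  shows "expresses le Ops \<tau> \<sigma>' \<rho>' n (map_num r \<phi>) h"
proof -
  have \<phi>: "is_formula Ops \<tau> \<sigma> \<phi>"
    using assms(1) by (simp add: expresses_def)
  show ?thesis
    using assms(1) is_formula_map_num[of Ops \<tau> \<sigma> \<phi> r \<sigma>', OF \<phi> assms(2)]
    by (simp add: expresses_def fv_map_num sem_map_num[of Ops \<tau> \<sigma> \<phi> \<rho>' r \<rho>, OF \<phi> assms(3)])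
qed

text \<open>Disjoint union of the two vocabularies: the symbols of the second formula are shifted
  past those of the first.\<close>

lemma definable_pair:
  assumes "definable le Ops \<tau> n g" "definable le Ops \<tau> n h"
  obtains \<sigma> \<rho> \<phi> \<psi> where "admissible Arb \<sigma> \<rho>"
    "expresses le Ops \<tau> \<sigma> \<rho> n \<phi> g" "expresses le Ops \<tau> \<sigma> \<rho> n \<psi> h"
proof -
  obtain \<sigma>1 \<rho>1 \<phi> where 1: "admissible Arb \<sigma>1 \<rho>1" "expresses le Ops \<tau> \<sigma>1 \<rho>1 n \<phi> g"
    using assms(1) by (auto simp: definable_def)
  obtain \<sigma>2 \<rho>2 \<psi> where 2: "admissible Arb \<sigma>2 \<rho>2" "expresses le Ops \<tau> \<sigma>2 \<rho>2 n \<psi> h"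
    using assms(2) by (auto simp: definable_def)
  define k where "k = length \<sigma>1"
  define \<rho> where "\<rho> m l = (case l of
      Pos P as \<Rightarrow> if P < k then \<rho>1 m (Pos P as) else \<rho>2 m (Pos (P - k) as)
    | Neg P as \<Rightarrow> if P < k then \<rho>1 m (Neg P as) else \<rho>2 m (Neg (P - k) as))" for m l
  have "expresses le Ops \<tau> (\<sigma>1 @ \<sigma>2) \<rho> n (map_num (\<lambda>P. P) \<phi>) g"
    by (rule expresses_map_num[OF 1(2)]) (auto simp: nth_append \<rho>_def k_def)
  moreover have "expresses le Ops \<tau> (\<sigma>1 @ \<sigma>2) \<rho> n (map_num (\<lambda>P. P + k) \<psi>) h"
    by (rule expresses_map_num[OF 2(2)]) (auto simp: nth_append \<rho>_def k_def)
  moreover have "admissible Arb (\<sigma>1 @ \<sigma>2) \<rho>"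
    unfolding admissible_def
  proof (intro allI impI)
    fix P assume P: "P < length (\<sigma>1 @ \<sigma>2)"
    show "\<exists>f\<in>Arb \<inter> Arb_arity ((\<sigma>1 @ \<sigma>2) ! P). \<exists>f'\<in>Arb \<inter> Arb_arity ((\<sigma>1 @ \<sigma>2) ! P).
        \<forall>n. \<forall>as\<in>tuples n ((\<sigma>1 @ \<sigma>2) ! P). \<rho> n (Pos P as) = f n as \<and> \<rho> n (Neg P as) = f' n as"
    proof (cases "P < k")
      case True
      then show ?thesis
        using 1(1) by (simp add: admissible_def nth_append \<rho>_def k_def)
    next
      case False
      then have "P - k < length \<sigma>2"
        using P by (simp add: k_def)
      then show ?thesis
        using 2(1) False by (simp add: admissible_def nth_append \<rho>_def k_def)
    qed
  qed
  ultimately show ?thesis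
    using that by blast
qed

lemma definable_add:
  assumes "definable le Ops \<tau> n g" "definable le Ops \<tau> n h"
  shows "definable le Ops \<tau> n (\<lambda>A \<pi> as. g A \<pi> as + h A \<pi> as)"
proof -
  obtain \<sigma> \<rho> \<phi> \<psi> where "admissible Arb \<sigma> \<rho>"
    "expresses le Ops \<tau> \<sigma> \<rho> n \<phi> g" "expresses le Ops \<tau> \<sigma> \<rho> n \<psi> h"
    using definable_pair[OF assms] .
  then show ?thesis
    unfolding definable_def expresses_def by (intro exI[of _ \<sigma>] exI[of _ \<rho>] exI[of _ "Or \<phi> \<psi>"]) auto
qed

lemma definable_mult:
  assumes "definable le Ops \<tau> n g" "definable le Ops \<tau> n h"
  shows "definable le Ops \<tau> n (\<lambda>A \<pi> as. g A \<pi> as * h A \<pi> as)"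
proof -
  obtain \<sigma> \<rho> \<phi> \<psi> where "admissible Arb \<sigma> \<rho>"
    "expresses le Ops \<tau> \<sigma> \<rho> n \<phi> g" "expresses le Ops \<tau> \<sigma> \<rho> n \<psi> h"
    using definable_pair[OF assms] .
  then show ?thesis
    unfolding definable_def expresses_def by (intro exI[of _ \<sigma>] exI[of _ \<rho>] exI[of _ "And \<phi> \<psi>"]) auto
qed

lemma definable_cmp:
  assumes "definable le Ops \<tau> n g" "definable le Ops \<tau> n h" "oper \<in> Ops"
  shows "definable le Ops \<tau> n
    (\<lambda>A \<pi> as. if cmp_holds le oper (g A \<pi> as) (h A \<pi> as) then 1 else 0)"
proof -
  obtain \<sigma> \<rho> \<phi> \<psi> where "admissible Arb \<sigma> \<rho>"
    "expresses le Ops \<tau> \<sigma> \<rho> n \<phi> g" "expresses le Ops \<tau> \<sigma> \<rho> n \<psi> h"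
    using definable_pair[OF assms(1,2)] .
  then show ?thesis
    unfolding definable_def expresses_def using assms(3)
    by (intro exI[of _ \<sigma>] exI[of _ \<rho>] exI[of _ "Cmp oper \<phi> \<psi>"]) auto
qed

text \<open>The source of non-uniformity: any function of the size and the ranks is the value of a
  single atom. With values 0 and 1 this gives arbitrary guards.\<close>

lemma definable_num:
  fixes le :: "'k::comm_semiring_1 \<Rightarrow> 'k \<Rightarrow> bool" and f :: "nat \<Rightarrow> nat list \<Rightarrow> 'k"
  shows "definable le Ops \<tau> n (\<lambda>A \<pi> as. f (card A) (map (rank A) as))"
proof -
  define \<rho> :: "nat \<Rightarrow> nat literal \<Rightarrow> 'k"
    where "\<rho> m l = (case l of Pos P as \<Rightarrow> f m as | Neg P as \<Rightarrow> f m as)" for m l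
  \<comment> \<open>Members of \<open>Arb_arity\<close> are undefined off the tuples in range, so
    \<open>f\<close> is restricted; \<open>admissible\<close> compares values on those tuples
    only.\<close>
  define f' where "f' m = restrict (f m) (tuples m n)" for m
  have "f' \<in> Arb_arity n"
    by (auto simp: Arb_arity_def f'_def)
  then have "admissible Arb [n] \<rho>"
    unfolding admissible_def by (auto simp: Arb_def \<rho>_def f'_def intro!: bexI[of _ f'])
  moreover have "expresses le Ops \<tau> [n] \<rho> n (Num 0 [0..<n])
      (\<lambda>A \<pi> as. f (card A) (map (rank A) as))"
    unfolding expresses_def by (auto simp: \<rho>_def)
  ultimately show ?thesis
    unfolding definable_def by blast
qed

text \<open>The first \<open>n\<close> variables are a context and the atom reads the remaining
  ones, which is the shape needed to quantify over the argument tuple.\<close>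

lemma definable_rel:
  assumes "R < length \<tau>"
  shows "definable le Ops \<tau> (n + \<tau> ! R) (\<lambda>A \<pi> as. \<pi> (Pos R (drop n as)))"
    and "definable le Ops \<tau> (n + \<tau> ! R) (\<lambda>A \<pi> as. \<pi> (Neg R (drop n as)))"
proof -
  have adm: "admissible Arb [] \<rho>" for \<rho> :: "nat \<Rightarrow> nat literal \<Rightarrow> 'k"
    by (simp add: admissible_def)
  have "expresses le Ops \<tau> [] \<rho> (n + \<tau> ! R) (Rel R [n..<n + \<tau> ! R]) (\<lambda>A \<pi> as. \<pi> (Pos R (drop n as)))"
    and "expresses le Ops \<tau> [] \<rho> (n + \<tau> ! R) (NRel R [n..<n + \<tau> ! R]) (\<lambda>A \<pi> as. \<pi> (Neg R (drop n as)))"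
    for \<rho>
    using assms by (auto simp: expresses_def drop_map)
  then show "definable le Ops \<tau> (n + \<tau> ! R) (\<lambda>A \<pi> as. \<pi> (Pos R (drop n as)))"
    and "definable le Ops \<tau> (n + \<tau> ! R) (\<lambda>A \<pi> as. \<pi> (Neg R (drop n as)))"
    unfolding definable_def using adm by blast+
qed

lemma definable_cong:
  assumes "definable le Ops \<tau> n h"
    and "\<And>A \<pi> as. finite A \<Longrightarrow> A \<noteq> {} \<Longrightarrow> length as = n \<Longrightarrow> set as \<subseteq> A \<Longrightarrow> h A \<pi> as = h' A \<pi> as"
  shows "definable le Ops \<tau> n h'"
proof -
  have "h A \<pi> (map s [0..<n]) = h' A \<pi> (map s [0..<n])"
    if "finite A" "A \<noteq> {}" "s ` {..<n} \<subseteq> A" for A \<pi> s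
    by (rule assms(2)) (use that in \<open>auto simp: image_subset_iff\<close>)
  then show ?thesis
    using assms(1) unfolding definable_def expresses_def by (metis (no_types, lifting))
qed

lemma expresses_Suc:
  assumes "expresses le Ops \<tau> \<sigma> \<rho> (Suc n) \<phi> h" "finite A" "A \<noteq> {}" "s ` {..<n} \<subseteq> A" "a \<in> A"
  shows "sem le A \<pi> \<rho> (s(n := a)) \<phi> = h A \<pi> (map s [0..<n] @ [a])"
proof -
  have "(s(n := a)) ` {..<Suc n} \<subseteq> A"
    using assms(4,5) by (auto simp: image_subset_iff less_Suc_eq)
  then have "sem le A \<pi> \<rho> (s(n := a)) \<phi> = h A \<pi> (map (s(n := a)) [0..<Suc n])"
    using assms(1-3) unfolding expresses_def by blast
  then show ?thesis
    by simp
qed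

lemma definable_Ex:
  assumes "definable le Ops \<tau> (Suc n) h"
  shows "definable le Ops \<tau> n (\<lambda>A \<pi> as. \<Sum>a\<in>A. h A \<pi> (as @ [a]))"
proof -
  obtain \<sigma> \<rho> \<phi> where adm: "admissible Arb \<sigma> \<rho>" and def: "expresses le Ops \<tau> \<sigma> \<rho> (Suc n) \<phi> h"
    using assms by (auto simp: definable_def)
  have "expresses le Ops \<tau> \<sigma> \<rho> n (Ex n \<phi>) (\<lambda>A \<pi> as. \<Sum>a\<in>A. h A \<pi> (as @ [a]))"
    unfolding expresses_def
  proof (intro conjI allI impI)
    show "is_formula Ops \<tau> \<sigma> (Ex n \<phi>)" "fv (Ex n \<phi>) \<subseteq> {..<n}"
      using def by (auto simp: expresses_def lessThan_Suc)
  qed (auto simp: expresses_Suc[OF def] intro!: sum.cong)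
  then show ?thesis
    using adm by (auto simp: definable_def)
qed

lemma definable_All:
  assumes "definable le Ops \<tau> (Suc n) h"
  shows "definable le Ops \<tau> n (\<lambda>A \<pi> as. \<Prod>a\<in>A. h A \<pi> (as @ [a]))"
proof -
  obtain \<sigma> \<rho> \<phi> where adm: "admissible Arb \<sigma> \<rho>" and def: "expresses le Ops \<tau> \<sigma> \<rho> (Suc n) \<phi> h"
    using assms by (auto simp: definable_def)
  have "expresses le Ops \<tau> \<sigma> \<rho> n (All n \<phi>) (\<lambda>A \<pi> as. \<Prod>a\<in>A. h A \<pi> (as @ [a]))"
    unfolding expresses_def
  proof (intro conjI allI impI)
    show "is_formula Ops \<tau> \<sigma> (All n \<phi>)" "fv (All n \<phi>) \<subseteq> {..<n}"
      using def by (auto simp: expresses_def lessThan_Suc)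
  qed (auto simp: expresses_Suc[OF def] intro!: prod.cong)
  then show ?thesis
    using adm by (auto simp: definable_def)
qed

section \<open>Quantification over tuples, fixed finite index sets, input values\<close>

definition lists_of :: "'a set \<Rightarrow> nat \<Rightarrow> 'a list set" where
  "lists_of A k = {as. length as = k \<and> set as \<subseteq> A}"

lemma lists_of_0: "lists_of A 0 = {[]}"
  by (auto simp: lists_of_def)

lemma lists_of_Suc: "lists_of A (Suc k) = (\<lambda>(a, as). a # as) ` (A \<times> lists_of A k)"
  by (auto simp: lists_of_def length_Suc_conv image_iff)

lemma finite_lists_of: "finite A \<Longrightarrow> finite (lists_of A k)"
  unfolding lists_of_def using finite_lists_length_eq[of A k] by (simp add: conj_commute)

lemma sum_lists_of_Suc:
  "(\<Sum>as\<in>lists_of A (Suc k). f as) = (\<Sum>a\<in>A. \<Sum>as\<in>lists_of A k. f (a # as))"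
  unfolding lists_of_Suc sum.cartesian_product
  by (subst sum.reindex) (auto simp: inj_on_def case_prod_beta)

lemma prod_lists_of_Suc:
  "(\<Prod>as\<in>lists_of A (Suc k). f as) = (\<Prod>a\<in>A. \<Prod>as\<in>lists_of A k. f (a # as))"
  unfolding lists_of_Suc prod.cartesian_product
  by (subst prod.reindex) (auto simp: inj_on_def case_prod_beta)

text \<open>The first component becomes the outermost quantifier and enlarges the context of the
  others, so the induction needs arbitrary \<open>n\<close>.\<close>

lemma definable_Ex_list:
  assumes "definable le Ops \<tau> (n + k) h"
  shows "definable le Ops \<tau> n (\<lambda>A \<pi> as. \<Sum>bs\<in>lists_of A k. h A \<pi> (as @ bs))"
  using assms
proof (induction k arbitrary: n)
  case 0
  then show ?case
    by (simp add: lists_of_0)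
next
  case (Suc k)
  then have "definable le Ops \<tau> (Suc n) (\<lambda>A \<pi> as. \<Sum>bs\<in>lists_of A k. h A \<pi> (as @ bs))"
    by simp
  from definable_Ex[OF this] show ?case
    by (simp add: sum_lists_of_Suc)
qed

lemma definable_All_list:
  assumes "definable le Ops \<tau> (n + k) h"
  shows "definable le Ops \<tau> n (\<lambda>A \<pi> as. \<Prod>bs\<in>lists_of A k. h A \<pi> (as @ bs))"
  using assms
proof (induction k arbitrary: n)
  case 0
  then show ?case
    by (simp add: lists_of_0)
next
  case (Suc k)
  then have "definable le Ops \<tau> (Suc n) (\<lambda>A \<pi> as. \<Prod>bs\<in>lists_of A k. h A \<pi> (as @ bs))"
    by simp
  from definable_All[OF this] show ?case
    by (simp add: prod_lists_of_Suc)
qed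

lemma definable_const: "definable le Ops \<tau> n (\<lambda>A \<pi> as. c)"
  using definable_num[of le Ops \<tau> n "\<lambda>_ _. c"] .

text \<open>Here \<open>I\<close> does not depend on the universe, so the sum unrolls into finitely
  many disjunctions. It serves for symbols, comparisons and indices below \<open>B\<close>.\<close>

lemma definable_sum:
  assumes "finite I" "\<And>i. i \<in> I \<Longrightarrow> definable le Ops \<tau> n (h i)"
  shows "definable le Ops \<tau> n (\<lambda>A \<pi> as. \<Sum>i\<in>I. h i A \<pi> as)"
  using assms by (induction I rule: finite_induct) (auto intro: definable_const definable_add)

lemma definable_prod:
  assumes "finite I" "\<And>i. i \<in> I \<Longrightarrow> definable le Ops \<tau> n (h i)"
  shows "definable le Ops \<tau> n (\<lambda>A \<pi> as. \<Prod>i\<in>I. h i A \<pi> as)"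
  using assms by (induction I rule: finite_induct) (auto intro: definable_const definable_mult)

lemma definable_drop:
  fixes f :: "nat \<Rightarrow> nat list \<Rightarrow> nat list \<Rightarrow> 'k::comm_semiring_1"
  shows "definable le Ops \<tau> (n + k)
    (\<lambda>A \<pi> as. f (card A) (map (rank A) (take n as)) (map (rank A) (drop n as)))"
  using definable_num[of le Ops \<tau> "n + k" "\<lambda>m ws. f m (take n ws) (drop n ws)"]
  by (simp add: take_map drop_map)

text \<open>The sum runs over all literals, each multiplied by a numerical guard stating that the
  requested position holds it. A position holds one literal, so one term survives; an index out of
  range satisfies no guard and yields 0.\<close>

lemma definable_input:
  fixes le :: "'k::comm_semiring_1 \<Rightarrow> 'k \<Rightarrow> bool" and idx :: "nat \<Rightarrow> nat list \<Rightarrow> nat"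
  shows "definable le Ops \<tau> n (\<lambda>(A :: 'a::linorder set) \<pi> as.
    if idx (card A) (map (rank A) as) < enc_length \<tau> (card A)
    then enc A \<tau> \<pi> ! idx (card A) (map (rank A) as) else 0)"
proof -
  define p q :: "nat \<Rightarrow> nat \<Rightarrow> nat list \<Rightarrow> nat list \<Rightarrow> 'k"
    where "p R m ws us = (if idx m ws < enc_length \<tau> m \<and> literals {1..m} \<tau> ! idx m ws = Pos R us
        then 1 else 0)"
      and "q R m ws us = (if idx m ws < enc_length \<tau> m \<and> literals {1..m} \<tau> ! idx m ws = Neg R us
        then 1 else 0)" for R m ws us
  define h where "h R A \<pi> as =
      (\<Sum>bs\<in>lists_of A (\<tau> ! R). p R (card A) (map (rank A) as) (map (rank A) bs) * \<pi> (Pos R bs)) +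
      (\<Sum>bs\<in>lists_of A (\<tau> ! R). q R (card A) (map (rank A) as) (map (rank A) bs) * \<pi> (Neg R bs))"
    for R and A :: "'a set" and \<pi> as
  have "definable le Ops \<tau> n (h R)" if R: "R < length \<tau>" for R
  proof -
    note P = definable_Ex_list[OF definable_mult[OF definable_drop[of le Ops \<tau> n "\<tau> ! R" "p R"]
          definable_rel(1)[OF R]]]
    note Q = definable_Ex_list[OF definable_mult[OF definable_drop[of le Ops \<tau> n "\<tau> ! R" "q R"]
          definable_rel(2)[OF R]]]
    show ?thesis
      by (rule definable_cong[OF definable_add[OF P Q]]) (simp add: h_def)
  qed
  then have "definable le Ops \<tau> n (\<lambda>A \<pi> as. \<Sum>R<length \<tau>. h R A \<pi> as)"
    by (intro definable_sum) auto
  then show ?thesis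
  proof (rule definable_cong)
    fix A :: "'a set" and \<pi> :: "'a literal \<Rightarrow> 'k" and as
    assume A: "finite A" "A \<noteq> {}"
    define i where "i = idx (card A) (map (rank A) as)"
    show "(\<Sum>R<length \<tau>. h R A \<pi> as) =
        (if idx (card A) (map (rank A) as) < enc_length \<tau> (card A)
         then enc A \<tau> \<pi> ! idx (card A) (map (rank A) as) else 0)"
    proof (cases "i < enc_length \<tau> (card A)")
      case False
      then show ?thesis
        by (simp add: h_def p_def q_def i_def)
    next
      case True
      then have i: "i < length (literals A \<tau>)"
        using A by (simp add: length_literals)
      have pq: "p R (card A) (map (rank A) as) (map (rank A) bs) =
            (if literals A \<tau> ! i = Pos R bs then 1 else 0)"
          "q R (card A) (map (rank A) as) (map (rank A) bs) =
            (if literals A \<tau> ! i = Neg R bs then 1 else 0)"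
        if "bs \<in> lists_of A k" for R bs k
        using that True literals_eq_rank_iff[OF A i, of bs R]
        by (auto simp: p_def q_def i_def lists_of_def)
      have h: "h R A \<pi> as =
          (\<Sum>bs\<in>lists_of A (\<tau> ! R). if literals A \<tau> ! i = Pos R bs then \<pi> (Pos R bs) else 0) +
          (\<Sum>bs\<in>lists_of A (\<tau> ! R). if literals A \<tau> ! i = Neg R bs then \<pi> (Neg R bs) else 0)" for R
        unfolding h_def by (intro arg_cong2[of _ _ _ _ plus] sum.cong refl) (simp_all add: pq)
      have delta: "(\<Sum>R<length \<tau>. \<Sum>bs\<in>lists_of A (\<tau> ! R). if R' = R \<and> bs' = bs then c R bs else 0) =
          c R' bs'" if "R' < length \<tau>" "bs' \<in> lists_of A (\<tau> ! R')"
        for R' bs' and c :: "nat \<Rightarrow> 'a list \<Rightarrow> 'k"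
      proof -
        have "(\<Sum>bs\<in>lists_of A (\<tau> ! R). if R' = R \<and> bs' = bs then c R bs else 0) =
            (if R' = R then c R' bs' else 0)" for R
          using that finite_lists_of[OF A(1)] by (auto simp: sum.delta')
        then show ?thesis
          using that by (simp add: sum.delta')
      qed
      have "literals A \<tau> ! i \<in> set (literals A \<tau>)"
        using i by simp
      then consider R' bs' where "literals A \<tau> ! i = Pos R' bs'" "R' < length \<tau>"
          "bs' \<in> lists_of A (\<tau> ! R')"
        | R' bs' where "literals A \<tau> ! i = Neg R' bs'" "R' < length \<tau>" "bs' \<in> lists_of A (\<tau> ! R')"
        unfolding set_literals[OF A] by (auto simp: lists_of_def)
      then have "(\<Sum>R<length \<tau>. h R A \<pi> as) = \<pi> (literals A \<tau> ! i)"
        by cases (simp_all add: h delta)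
      then show ?thesis
        using True i by (simp add: enc_def i_def)
    qed
  qed
qed
section \<open>From circuits to formulas\<close>

fun const_part :: "'k::comm_semiring_1 label \<Rightarrow> 'k" where
  "const_part (Const c) = c"
| "const_part _ = 0"

fun sum_preds :: "'k label \<Rightarrow> nat set" where
  "sum_preds (Plus S) = S"
| "sum_preds (Out a) = {a}"
| "sum_preds _ = {}"

fun prod_preds :: "'k label \<Rightarrow> nat set" where
  "prod_preds (Times S) = S"
| "prod_preds _ = {}"

fun left_preds :: "'k label \<Rightarrow> nat set" where
  "left_preds (Compare oper a b) = {a}"
| "left_preds _ = {}"

fun right_preds :: "'k label \<Rightarrow> nat set" where
  "right_preds (Compare oper a b) = {b}"
| "right_preds _ = {}"

lemma finite_cmp: "finite (Ops :: cmp set)"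
proof (rule finite_subset)
  show "Ops \<subseteq> {EQ, NEQ, LE, NLE}"
    using cmp.exhaust by blast
qed simp

text \<open>Replaces the case distinction on the label by a sum in which the terms of the other
  kinds vanish. Products and comparisons need explicit guards, because an empty product is 1 and
  comparing 0 with 0 may yield 1. Operands are written as sums over at most one gate, so that they
  are treated like other sums; output gates count as unary sums.\<close>

lemma label_value_split:
  assumes "\<And>oper a b. l = Compare oper a b \<Longrightarrow> oper \<in> Ops"
  shows "label_value le x l v = const_part l + (if \<exists>i. l = In i then x ! (THE i. l = In i) else 0) +
    (\<Sum>h\<in>sum_preds l. v h) + (if \<exists>S. l = Times S then 1 else 0) * (\<Prod>h\<in>prod_preds l. v h) +
    (\<Sum>oper\<in>Ops. (if \<exists>a b. l = Compare oper a b then 1 else 0) *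
       (if cmp_holds le oper (\<Sum>h\<in>left_preds l. v h) (\<Sum>h\<in>right_preds l. v h) then 1 else 0))"
proof (cases l)
  case (Compare oper a b)
  have "(\<Sum>oper'\<in>Ops. (if oper = oper' then 1 else 0) * c oper') = (c oper :: 'a)" for c
  proof -
    have "(\<Sum>oper'\<in>Ops. (if oper = oper' then 1 else 0) * c oper') =
        (\<Sum>oper'\<in>Ops. if oper = oper' then c oper' else 0)"
      by (intro sum.cong) auto
    then show ?thesis
      using assms[OF Compare] finite_cmp by simp
  qed
  then show ?thesis
    using Compare by simp
qed auto

text \<open>Circuits are indexed by the size \<open>m\<close> of the universe and not by the input
  length. The second component of a code is a tuple of ranks, so numerical predicates can refer to
  gates.\<close>

locale coded_circuits =
  fixes le :: "'k::comm_semiring_1 \<Rightarrow> 'k \<Rightarrow> bool" and Ops :: "cmp set" and \<tau> :: vocab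
    and C :: "nat \<Rightarrow> 'k circuit" and B q :: nat and code :: "nat \<Rightarrow> nat \<Rightarrow> nat \<times> nat list"
  assumes circuit: "arith_circuit Ops (enc_length \<tau> m) (C m)"
    and code_inj: "m \<ge> 1 \<Longrightarrow> inj_on (code m) (gates (C m))"
    and code_range: "m \<ge> 1 \<Longrightarrow> code m ` gates (C m) \<subseteq> {..<B} \<times> tuples m q"
begin

definition ev :: "nat \<Rightarrow> 'a::linorder set \<Rightarrow> ('a literal \<Rightarrow> 'k) \<Rightarrow> nat \<Rightarrow> 'k" where
  "ev d A \<pi> = bounded_value le (C (card A)) (enc A \<tau> \<pi>) d"

text \<open>A set with at most one gate for \<open>m \<ge> 1\<close>; sums over it give the default
  0 at tuples that name no gate.\<close>

definition decode :: "nat \<Rightarrow> nat \<Rightarrow> nat list \<Rightarrow> nat set" where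
  "decode m j us = {g \<in> gates (C m). code m g = (j, us)}"

definition coded_ev ::
    "nat \<Rightarrow> nat \<Rightarrow> 'a::linorder set \<Rightarrow> ('a literal \<Rightarrow> 'k) \<Rightarrow> 'a list \<Rightarrow> 'k" where
  "coded_ev d j A \<pi> ys = (\<Sum>g\<in>decode (card A) j (map (rank A) ys). ev d A \<pi> g)"

lemma preds_in_gates: "g \<in> gates (C m) \<Longrightarrow> preds (label (C m) g) \<subseteq> gates (C m)"
  using circuit[of m] by (auto simp: arith_circuit_def edges_def)

lemma decode_cases:
  assumes "m \<ge> 1"
  obtains "decode m j us = {}" | g where "g \<in> gates (C m)" "decode m j us = {g}"
proof (cases "decode m j us = {}")
  case False
  then obtain g where g: "g \<in> gates (C m)" "code m g = (j, us)"
    by (auto simp: decode_def)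
  then have "decode m j us = {g}"
    using inj_onD[OF code_inj[OF assms]] by (fastforce simp: decode_def)
  then show ?thesis
    using that g by blast
qed (use that in blast)

text \<open>Turns codes made of ranks into codes \<open>c\<close> made of elements of
  \<open>A\<close>, over which the quantifiers range.\<close>

lemma coding:
  fixes A :: "'a::linorder set"
  assumes A: "finite A" "A \<noteq> {}"
  obtains c where "inj_on c (gates (C (card A)))"
    "c ` gates (C (card A)) \<subseteq> {..<B} \<times> lists_of A q"
    "\<And>g j ys. g \<in> gates (C (card A)) \<Longrightarrow> ys \<in> lists_of A q \<Longrightarrow>
      code (card A) g = (j, map (rank A) ys) \<longleftrightarrow> c g = (j, ys)"
    "\<And>d \<pi> g. g \<in> gates (C (card A)) \<Longrightarrow>
      coded_ev d (fst (c g)) A \<pi> (snd (c g)) = ev d A \<pi> g"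
proof -
  let ?G = "gates (C (card A))" and ?unrank = "inv_into A (rank A)"
  have card: "card A \<ge> 1"
    using A by (simp add: Suc_le_eq card_gt_0_iff)
  define c where "c g = (fst (code (card A) g), map ?unrank (snd (code (card A) g)))" for g
  have code: "fst (code (card A) g) < B" "length (snd (code (card A) g)) = q"
      "set (snd (code (card A) g)) \<subseteq> rank A ` A" if "g \<in> ?G" for g
    using that code_range[OF card] unfolding rank_image[OF A(1)] by (fastforce simp: tuples_def)+
  have range: "c g \<in> {..<B} \<times> lists_of A q" if "g \<in> ?G" for g
    using code[OF that] by (auto simp: c_def lists_of_def intro!: inv_into_into)
  have rank_c: "code (card A) g = (fst (c g), map (rank A) (snd (c g)))" if "g \<in> ?G" for g
  proof -
    have "map (rank A) (map ?unrank us) = us" if "set us \<subseteq> rank A ` A" for us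
      unfolding map_map by (rule map_idI) (use that in \<open>auto simp: f_inv_into_f\<close>)
    then show ?thesis
      using code(3)[OF that] by (simp add: c_def)
  qed
  have iff: "code (card A) g = (j, map (rank A) ys) \<longleftrightarrow> c g = (j, ys)"
    if "g \<in> ?G" "ys \<in> lists_of A q" for g j ys
    using rank_c[OF that(1)] range[OF that(1)] that(2) map_rank_inj[OF A(1), of "snd (c g)" ys]
    by (cases "c g") (auto simp: lists_of_def)
  have inj: "inj_on c ?G"
    by (rule inj_onI) (metis code_inj[OF card] inj_onD rank_c)
  have "coded_ev d (fst (c g)) A \<pi> (snd (c g)) = ev d A \<pi> g" if "g \<in> ?G" for d \<pi> g
  proof -
    have "decode (card A) (fst (c g)) (map (rank A) (snd (c g))) = {g}"
      using that rank_c[OF that] inj_onD[OF code_inj[OF card]] by (auto simp: decode_def)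
    then show ?thesis
      by (simp add: coded_ev_def)
  qed
  then show ?thesis
    using that inj range iff by blast
qed

text \<open>Summing over all possible codes, with a guard for the codes of gates in
  \<open>T\<close>, hits every gate of \<open>T\<close> once because coding is injective.\<close>

lemma coded_sum:
  fixes A :: "'a::linorder set"
  assumes A: "finite A" "A \<noteq> {}" and T: "T \<subseteq> gates (C (card A))"
  shows "(\<Sum>j<B. \<Sum>ys\<in>lists_of A q.
      (if \<exists>g\<in>T. code (card A) g = (j, map (rank A) ys) then 1 else 0) * coded_ev d j A \<pi> ys) =
    (\<Sum>g\<in>T. ev d A \<pi> g)"
proof -
  obtain c where c: "inj_on c (gates (C (card A)))"
    "c ` gates (C (card A)) \<subseteq> {..<B} \<times> lists_of A q"
    "\<And>g j ys. g \<in> gates (C (card A)) \<Longrightarrow> ys \<in> lists_of A q \<Longrightarrow>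
      code (card A) g = (j, map (rank A) ys) \<longleftrightarrow> c g = (j, ys)"
    "\<And>d \<pi> g. g \<in> gates (C (card A)) \<Longrightarrow>
      coded_ev d (fst (c g)) A \<pi> (snd (c g)) = ev d A \<pi> g"
    using coding[OF A] by blast
  let ?P = "{..<B} \<times> lists_of A q" and ?F = "\<lambda>p. coded_ev d (fst p) A \<pi> (snd p)"
  have "(\<Sum>j<B. \<Sum>ys\<in>lists_of A q.
      (if \<exists>g\<in>T. code (card A) g = (j, map (rank A) ys) then 1 else 0) * coded_ev d j A \<pi> ys) =
      (\<Sum>p\<in>?P. if p \<in> c ` T then ?F p else 0)"
    unfolding sum.cartesian_product
  proof (rule sum.cong)
    fix p assume "p \<in> ?P"
    then obtain j ys where p: "p = (j, ys)" "ys \<in> lists_of A q"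
      by blast
    have "(\<exists>g\<in>T. code (card A) g = (j, map (rank A) ys)) \<longleftrightarrow> p \<in> c ` T"
      using T c(3)[OF _ p(2)] by (auto simp: p(1) image_iff) (metis subsetD)+
    then show "(case p of (j, ys) \<Rightarrow>
        (if \<exists>g\<in>T. code (card A) g = (j, map (rank A) ys) then 1 else 0) * coded_ev d j A \<pi> ys) =
        (if p \<in> c ` T then ?F p else 0)"
      by (simp add: p(1))
  qed simp
  also have "\<dots> = (\<Sum>p\<in>?P \<inter> c ` T. ?F p)"
    by (rule sum.inter_restrict[symmetric]) (simp add: finite_lists_of A)
  also have "?P \<inter> c ` T = c ` T"
    using T c(2) by blast
  also have "(\<Sum>p\<in>c ` T. ?F p) = (\<Sum>g\<in>T. ?F (c g))"
    using c(1) T by (simp add: sum.reindex inj_on_subset)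
  also have "\<dots> = (\<Sum>g\<in>T. ev d A \<pi> g)"
    using T c(4) by (intro sum.cong) auto
  finally show ?thesis .
qed

text \<open>The second summand turns the factor of a code outside \<open>T\<close> into 1. It is a
  separate guard, as a semiring cannot form the complement by subtraction.\<close>

lemma coded_prod:
  fixes A :: "'a::linorder set"
  assumes A: "finite A" "A \<noteq> {}" and T: "T \<subseteq> gates (C (card A))"
  shows "(\<Prod>j<B. \<Prod>ys\<in>lists_of A q.
      (if \<exists>g\<in>T. code (card A) g = (j, map (rank A) ys) then 1 else 0) * coded_ev d j A \<pi> ys +
      (if \<exists>g\<in>T. code (card A) g = (j, map (rank A) ys) then 0 else 1)) =
    (\<Prod>g\<in>T. ev d A \<pi> g)"
proof -
  obtain c where c: "inj_on c (gates (C (card A)))"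
    "c ` gates (C (card A)) \<subseteq> {..<B} \<times> lists_of A q"
    "\<And>g j ys. g \<in> gates (C (card A)) \<Longrightarrow> ys \<in> lists_of A q \<Longrightarrow>
      code (card A) g = (j, map (rank A) ys) \<longleftrightarrow> c g = (j, ys)"
    "\<And>d \<pi> g. g \<in> gates (C (card A)) \<Longrightarrow>
      coded_ev d (fst (c g)) A \<pi> (snd (c g)) = ev d A \<pi> g"
    using coding[OF A] by blast
  let ?P = "{..<B} \<times> lists_of A q" and ?F = "\<lambda>p. coded_ev d (fst p) A \<pi> (snd p)"
  have "(\<Prod>j<B. \<Prod>ys\<in>lists_of A q.
      (if \<exists>g\<in>T. code (card A) g = (j, map (rank A) ys) then 1 else 0) * coded_ev d j A \<pi> ys +
      (if \<exists>g\<in>T. code (card A) g = (j, map (rank A) ys) then 0 else 1)) =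
      (\<Prod>p\<in>?P. if p \<in> c ` T then ?F p else 1)"
    unfolding prod.cartesian_product
  proof (rule prod.cong)
    fix p assume "p \<in> ?P"
    then obtain j ys where p: "p = (j, ys)" "ys \<in> lists_of A q"
      by blast
    have "(\<exists>g\<in>T. code (card A) g = (j, map (rank A) ys)) \<longleftrightarrow> p \<in> c ` T"
      using T c(3)[OF _ p(2)] by (auto simp: p(1) image_iff) (metis subsetD)+
    then show "(case p of (j, ys) \<Rightarrow>
        (if \<exists>g\<in>T. code (card A) g = (j, map (rank A) ys) then 1 else 0) * coded_ev d j A \<pi> ys +
        (if \<exists>g\<in>T. code (card A) g = (j, map (rank A) ys) then 0 else 1)) =
        (if p \<in> c ` T then ?F p else 1)"
      by (simp add: p(1))
  qed simp
  also have "\<dots> = (\<Prod>p\<in>?P \<inter> c ` T. ?F p)"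
    by (rule prod.inter_restrict[symmetric]) (simp add: finite_lists_of A)
  also have "?P \<inter> c ` T = c ` T"
    using T c(2) by blast
  also have "(\<Prod>p\<in>c ` T. ?F p) = (\<Prod>g\<in>T. ?F (c g))"
    using c(1) T by (simp add: prod.reindex inj_on_subset)
  also have "\<dots> = (\<Prod>g\<in>T. ev d A \<pi> g)"
    using T c(4) by (intro prod.cong) auto
  finally show ?thesis .
qed

section \<open>From depth \<open>d\<close> to depth \<open>d + 1\<close>\<close>

context
  fixes d :: nat and U :: "'a::linorder itself"
  assumes coded: "definable le Ops \<tau> (n + q)
    (\<lambda>(A :: 'a set) \<pi> as. coded_ev d j A \<pi> (drop n as))"
begin

text \<open>\<open>T\<close> may depend arbitrarily on the size and the ranks, because for each
  index below \<open>B\<close> its membership test is one numerical predicate.\<close>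

lemma definable_gate_sum:
  assumes T: "\<And>m ws. m \<ge> 1 \<Longrightarrow> T m ws \<subseteq> gates (C m)"
  shows "definable le Ops \<tau> n
    (\<lambda>(A :: 'a set) \<pi> as. \<Sum>g\<in>T (card A) (map (rank A) as). ev d A \<pi> g)"
proof -
  define p :: "nat \<Rightarrow> nat \<Rightarrow> nat list \<Rightarrow> nat list \<Rightarrow> 'k"
    where "p j m ws us = (if \<exists>g\<in>T m ws. code m g = (j, us) then 1 else 0)" for j m ws us
  note 1 = definable_mult[OF definable_drop[of le Ops \<tau> n q "p _"] coded]
  note 2 = definable_sum[OF finite_lessThan[of B] definable_Ex_list[OF 1]]
  show ?thesis
  proof (rule definable_cong[OF 2])
    fix A :: "'a set" and \<pi> :: "'a literal \<Rightarrow> 'k" and as :: "'a list"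
    assume A: "finite A" "A \<noteq> {}" and as: "length as = n"
    have "T (card A) (map (rank A) as) \<subseteq> gates (C (card A))"
      using A T by (simp add: Suc_le_eq card_gt_0_iff)
    from coded_sum[OF A this, of d \<pi>] show "(\<Sum>j<B. \<Sum>bs\<in>lists_of A q.
        p j (card A) (map (rank A) (take n (as @ bs))) (map (rank A) (drop n (as @ bs))) *
        coded_ev d j A \<pi> (drop n (as @ bs))) =
        (\<Sum>g\<in>T (card A) (map (rank A) as). ev d A \<pi> g)"
      by (simp add: p_def as)
  qed
qed

lemma definable_gate_prod:
  assumes T: "\<And>m ws. m \<ge> 1 \<Longrightarrow> T m ws \<subseteq> gates (C m)"
  shows "definable le Ops \<tau> n
    (\<lambda>(A :: 'a set) \<pi> as. \<Prod>g\<in>T (card A) (map (rank A) as). ev d A \<pi> g)"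
proof -
  define p p' :: "nat \<Rightarrow> nat \<Rightarrow> nat list \<Rightarrow> nat list \<Rightarrow> 'k"
    where "p j m ws us = (if \<exists>g\<in>T m ws. code m g = (j, us) then 1 else 0)"
      and "p' j m ws us = (if \<exists>g\<in>T m ws. code m g = (j, us) then 0 else 1)" for j m ws us
  note 1 = definable_add[OF definable_mult[OF definable_drop[of le Ops \<tau> n q "p _"] coded]
      definable_drop[of le Ops \<tau> n q "p' _"]]
  note 2 = definable_prod[OF finite_lessThan[of B] definable_All_list[OF 1]]
  show ?thesis
  proof (rule definable_cong[OF 2])
    fix A :: "'a set" and \<pi> :: "'a literal \<Rightarrow> 'k" and as :: "'a list"
    assume A: "finite A" "A \<noteq> {}" and as: "length as = n"
    have "T (card A) (map (rank A) as) \<subseteq> gates (C (card A))"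
      using A T by (simp add: Suc_le_eq card_gt_0_iff)
    from coded_prod[OF A this, of d \<pi>] show "(\<Prod>j<B. \<Prod>bs\<in>lists_of A q.
        p j (card A) (map (rank A) (take n (as @ bs))) (map (rank A) (drop n (as @ bs))) *
        coded_ev d j A \<pi> (drop n (as @ bs)) +
        p' j (card A) (map (rank A) (take n (as @ bs))) (map (rank A) (drop n (as @ bs)))) =
        (\<Prod>g\<in>T (card A) (map (rank A) as). ev d A \<pi> g)"
      by (simp add: p_def p'_def as)
  qed
qed

text \<open>The terms of \<open>label_value_split\<close> are defined one by one: labels and edges
  go into numerical functions, and only values of predecessors use the assumption on depth
  \<open>d\<close>.\<close>

lemma definable_coded_ev_Suc:
  "definable le Ops \<tau> (n + q) (\<lambda>(A :: 'a set) \<pi> as. coded_ev (Suc d) j A \<pi> (drop n as))"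
proof -
  let ?D = "\<lambda>m ws. decode m j (drop n ws)"
  \<comment> \<open>\<open>enc_length \<tau> m\<close> is out of range and signals that the named
    gate is no input gate.\<close>
  define idx where "idx m ws = (if \<exists>g\<in>?D m ws. \<exists>i. label (C m) g = In i
    then THE i. \<exists>g\<in>?D m ws. label (C m) g = In i else enc_length \<tau> m)" for m ws
  define con :: "nat \<Rightarrow> nat list \<Rightarrow> 'k"
    where "con m ws = (\<Sum>g\<in>?D m ws. const_part (label (C m) g))" for m ws
  define times :: "nat \<Rightarrow> nat list \<Rightarrow> 'k"
    where "times m ws = (if \<exists>g\<in>?D m ws. \<exists>S. label (C m) g = Times S then 1 else 0)" for m ws
  define compare :: "cmp \<Rightarrow> nat \<Rightarrow> nat list \<Rightarrow> 'k"
    where "compare oper m ws =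
      (if \<exists>g\<in>?D m ws. \<exists>a b. label (C m) g = Compare oper a b then 1 else 0)" for oper m ws
  have preds: "(\<Union>g\<in>?D m ws. P (label (C m) g)) \<subseteq> gates (C m)"
    if "\<And>l. P l \<subseteq> preds l" for P :: "'k label \<Rightarrow> nat set" and m ws
    using preds_in_gates that by (fastforce simp: decode_def)
  have sub: "sum_preds l \<subseteq> preds l" "prod_preds l \<subseteq> preds l"
      "left_preds l \<subseteq> preds l" "right_preds l \<subseteq> preds l" for l :: "'k label"
    by (cases l; simp)+
  note S = definable_gate_sum[of "\<lambda>m ws. \<Union>g\<in>?D m ws. sum_preds (label (C m) g)", OF preds[OF sub(1)]]
  note P = definable_gate_prod[of "\<lambda>m ws. \<Union>g\<in>?D m ws. prod_preds (label (C m) g)", OF preds[OF sub(2)]]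
  note L = definable_gate_sum[of "\<lambda>m ws. \<Union>g\<in>?D m ws. left_preds (label (C m) g)", OF preds[OF sub(3)]]
  note R = definable_gate_sum[of "\<lambda>m ws. \<Union>g\<in>?D m ws. right_preds (label (C m) g)", OF preds[OF sub(4)]]
  note M = definable_mult[OF definable_num[of le Ops \<tau> _ times] P]
  note Cm = definable_sum[OF finite_cmp[of Ops]
      definable_mult[OF definable_num[of le Ops \<tau> _ "compare _"] definable_cmp[OF L R]]]
  show ?thesis
  proof (rule definable_cong[OF definable_add[OF definable_add[OF definable_add[OF definable_add[OF
            definable_num[of le Ops \<tau> _ con] definable_input[of le Ops \<tau> _ idx]] S] M] Cm]])
    fix A :: "'a set" and \<pi> :: "'a literal \<Rightarrow> 'k" and as :: "'a list"
    assume A: "finite A" "A \<noteq> {}" and as: "length as = n + q"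
    have card: "card A \<ge> 1"
      using A by (simp add: Suc_le_eq card_gt_0_iff)
    let ?ws = "map (rank A) as" and ?m = "card A"
    show "con ?m ?ws +
        (if idx ?m ?ws < enc_length \<tau> ?m then enc A \<tau> \<pi> ! idx ?m ?ws else 0) +
        (\<Sum>g\<in>(\<Union>g\<in>?D ?m ?ws. sum_preds (label (C ?m) g)). ev d A \<pi> g) +
        times ?m ?ws * (\<Prod>g\<in>(\<Union>g\<in>?D ?m ?ws. prod_preds (label (C ?m) g)). ev d A \<pi> g) +
        (\<Sum>oper\<in>Ops. compare oper ?m ?ws *
          (if cmp_holds le oper (\<Sum>g\<in>(\<Union>g\<in>?D ?m ?ws. left_preds (label (C ?m) g)). ev d A \<pi> g)
             (\<Sum>g\<in>(\<Union>g\<in>?D ?m ?ws. right_preds (label (C ?m) g)). ev d A \<pi> g) then 1 else 0)) =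
        coded_ev (Suc d) j A \<pi> (drop n as)"
    proof (rule decode_cases[OF card, of j "drop n ?ws"])
      \<comment> \<open>For tuples naming no gate all guards vanish, and both sides are 0.\<close>
      assume "?D ?m ?ws = {}"
      then show ?thesis
        by (simp add: con_def idx_def times_def compare_def coded_ev_def drop_map)
    next
      fix g assume g: "g \<in> gates (C ?m)" "?D ?m ?ws = {g}"
      have "oper \<in> Ops" if "label (C ?m) g = Compare oper a b" for oper a b
        using circuit[of ?m] that g(1) by (auto simp: arith_circuit_def)
      then have split: "label_value le x (label (C ?m) g) v = const_part (label (C ?m) g) +
          (if \<exists>i. label (C ?m) g = In i then x ! (THE i. label (C ?m) g = In i) else 0) +
          (\<Sum>h\<in>sum_preds (label (C ?m) g). v h) +
          (if \<exists>S. label (C ?m) g = Times S then 1 else 0) * (\<Prod>h\<in>prod_preds (label (C ?m) g). v h) +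
          (\<Sum>oper\<in>Ops. (if \<exists>a b. label (C ?m) g = Compare oper a b then 1 else 0) *
            (if cmp_holds le oper (\<Sum>h\<in>left_preds (label (C ?m) g). v h)
               (\<Sum>h\<in>right_preds (label (C ?m) g). v h) then 1 else 0))" for x v
        by (rule label_value_split)
      have "i < enc_length \<tau> ?m" if "label (C ?m) g = In i" for i
        using circuit[of ?m] that g(1) by (auto simp: arith_circuit_def)
      then have inp: "(if idx ?m ?ws < enc_length \<tau> ?m then enc A \<tau> \<pi> ! idx ?m ?ws else 0) =
          (if \<exists>i. label (C ?m) g = In i then enc A \<tau> \<pi> ! (THE i. label (C ?m) g = In i) else 0)"
        by (auto simp: idx_def g(2))
      have "coded_ev (Suc d) j A \<pi> (drop n as) = label_value le (enc A \<tau> \<pi>) (label (C ?m) g) (ev d A \<pi>)"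
        using g(2) by (simp add: coded_ev_def ev_def drop_map)
      then show ?thesis
        unfolding inp split by (simp add: con_def times_def compare_def g(2))
    qed
  qed
qed

end

text \<open>The codes of predecessors are quantified behind the variables naming the gate itself, so
  the hypothesis is needed for a larger context; hence the arbitrary \<open>n\<close>.\<close>

lemma definable_coded_ev:
  "definable le Ops \<tau> (n + q)
    (\<lambda>(A :: 'a::linorder set) \<pi> as. coded_ev d j A \<pi> (drop n as))"
proof (induction d arbitrary: n j)
  case 0
  show ?case
    by (rule definable_cong[OF definable_const[of le Ops \<tau> _ 0]]) (simp add: coded_ev_def ev_def)
next
  case (Suc d)
  show ?case
    by (rule definable_coded_ev_Suc[OF Suc.IH])
qed

text \<open>The output gate depends only on the size of the universe, so a sum over this single gate
  removes the variables that name it.\<close>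

lemma definable_circuit_fun:
  assumes depth: "\<And>m. circuit_depth (C m) < d"
  shows "definable le Ops \<tau> 0
    (\<lambda>(A :: 'a::linorder set) \<pi> as. circuit_fun le (C (card A)) (enc A \<tau> \<pi>))"
proof -
  have "\<exists>g. g \<in> gates (C m) \<and> (\<forall>x. circuit_fun le (C m) x = bounded_value le (C m) x d g)" for m
    using circuit_fun_bounded_value[OF circuit depth, of m le] by metis
  then obtain out where out: "\<And>m. out m \<in> gates (C m)"
      "\<And>m x. circuit_fun le (C m) x = bounded_value le (C m) x d (out m)"
    by metis
  have "definable le Ops \<tau> 0
      (\<lambda>(A :: 'a set) \<pi> as. \<Sum>g\<in>{out (card A)}. ev d A \<pi> g)"
    using definable_gate_sum[OF definable_coded_ev, of "\<lambda>m ws. {out m}" 0 d] out(1) by simp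
  then show ?thesis
    by (simp add: ev_def out(2))
qed

end

section \<open>Codes for a circuit family of polynomial size\<close>

lemma bigo_power_bound:
  fixes s :: "nat \<Rightarrow> nat"
  assumes "(\<lambda>n. real (s n)) \<in> O(\<lambda>n. real n ^ k)"
  obtains c where "\<And>n. n \<ge> 1 \<Longrightarrow> s n \<le> c * n ^ k"
proof -
  obtain a where a: "a > 0" "eventually (\<lambda>n. norm (real (s n)) \<le> a * norm (real n ^ k)) at_top"
    using assms by (rule landau_o.bigE)
  then obtain N where N: "\<And>n. n \<ge> N \<Longrightarrow> real (s n) \<le> a * real n ^ k"
    by (auto simp: eventually_at_top_linorder)
  \<comment> \<open>The sum absorbs the finitely many sizes below the threshold \<open>N\<close>;
    this suffices since \<open>n ^ k\<close> is at least 1.\<close>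
  define c where "c = nat \<lceil>a\<rceil> + (\<Sum>i<N. s i)"
  have "s n \<le> c * n ^ k" if n: "n \<ge> 1" for n
  proof (cases "n < N")
    case True
    then have "s n \<le> c"
      unfolding c_def by (intro trans_le_add2 member_le_sum) auto
    also have "\<dots> \<le> c * n ^ k"
      using n by simp
    finally show ?thesis .
  next
    case False
    have "a \<le> real c"
      unfolding c_def by linarith
    then have "a * real n ^ k \<le> real c * real n ^ k"
      by (intro mult_right_mono) auto
    then have "real (s n) \<le> real (c * n ^ k)"
      using N[of n] False by simp
    then show ?thesis
      by (simp only: of_nat_le_iff)
  qed
  then show ?thesis
    by (rule that)
qed

lemma finite_tuples: "finite (tuples m q)"
  and card_tuples: "card (tuples m q) = m ^ q"
proof -
  have eq: "tuples m q = {xs. set xs \<subseteq> {1..m} \<and> length xs = q}"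
    by (auto simp: tuples_def)
  show "finite (tuples m q)"
    unfolding eq by (rule finite_lists_length_eq) simp
  show "card (tuples m q) = m ^ q"
    unfolding eq by (simp add: card_lists_length_eq)
qed

lemma FAC0_definable:
  fixes le :: "'k::comm_semiring_1 \<Rightarrow> 'k \<Rightarrow> bool"
  assumes "\<tau> \<noteq> []" "f \<in> FAC0 le Ops"
  shows "definable le Ops \<tau> 0 (\<lambda>(A :: 'a::linorder set) \<pi> as. f (enc A \<tau> \<pi>))"
proof -
  obtain C k where C: "\<And>n. arith_circuit Ops n (C n)"
    and size: "(\<lambda>n. real (circuit_size (C n))) \<in> O(\<lambda>n. real n ^ k)"
    and depth: "(\<lambda>n. real (circuit_depth (C n))) \<in> O(\<lambda>_. 1)"
    and f: "\<And>x. f x = circuit_fun le (C (length x)) x"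
    using assms(2) unfolding FAC0_def by blast
  let ?n = "enc_length \<tau>"
  have n_ge: "?n m \<ge> 1" if "m \<ge> 1" for m
    using enc_length_ge[OF assms(1), of m] that by linarith
  obtain c where c: "\<And>n. n \<ge> 1 \<Longrightarrow> circuit_size (C n) \<le> c * n ^ k"
    using bigo_power_bound[OF size] by blast
  have "(\<lambda>n. real (circuit_depth (C n))) \<in> O(\<lambda>n. real n ^ 0)"
    using depth by simp
  from bigo_power_bound[OF this]
  obtain d where "\<And>n. n \<ge> 1 \<Longrightarrow> circuit_depth (C n) \<le> d * n ^ 0"
    by blast
  \<comment> \<open>The bound \<open>d\<close> holds only for \<open>n \<ge> 1\<close>; the depth at
    input length 0 is added to cover all lengths.\<close>
  then have "circuit_depth (C n) < Suc (d + circuit_depth (C 0))" for n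
    by (cases "n = 0") (auto simp: less_Suc_eq_le intro: trans_le_add1)
  note depth = this
  \<comment> \<open>Both come from inserting the bound \<open>enc_length_le\<close> into
    \<open>c * n ^ k\<close>.\<close>
  define B where "B = c * (2 * length \<tau>) ^ k"
  define q where "q = Suc (sum_list \<tau>) * k"
  have card: "card (gates (C (?n m))) \<le> card ({..<B} \<times> tuples m q)" if "m \<ge> 1" for m
  proof -
    have "card (gates (C (?n m))) \<le> c * ?n m ^ k"
      using c[OF n_ge[OF that]] by (simp add: circuit_size_def)
    also have "\<dots> \<le> c * (2 * length \<tau> * m ^ Suc (sum_list \<tau>)) ^ k"
      using enc_length_le[OF that] by (intro mult_left_mono power_mono) auto
    also have "\<dots> = B * m ^ q"
      by (simp only: B_def q_def power_mult_distrib power_mult mult.assoc)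
    finally show ?thesis
      by (simp add: card_cartesian_product card_tuples)
  qed
  \<comment> \<open>Counting alone provides a code. It may be arbitrary, because the numerical
    predicates that describe it may be.\<close>
  have "\<exists>e. inj_on e (gates (C (?n m))) \<and> e ` gates (C (?n m)) \<subseteq> {..<B} \<times> tuples m q" if "m \<ge> 1" for m
  proof -
    have "finite (gates (C (?n m)))"
      using C by (simp add: arith_circuit_def)
    then show ?thesis
      using card_le_inj[OF _ _ card[OF that]] finite_tuples by (metis finite_SigmaI finite_lessThan)
  qed
  then obtain code where code: "\<And>m. m \<ge> 1 \<Longrightarrow> inj_on (code m) (gates (C (?n m)))"
      "\<And>m. m \<ge> 1 \<Longrightarrow> code m ` gates (C (?n m)) \<subseteq> {..<B} \<times> tuples m q"
    by metis
  interpret coded_circuits le Ops \<tau> "\<lambda>m. C (?n m)" B q code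
    by unfold_locales (use C code in auto)
  have "definable le Ops \<tau> 0
      (\<lambda>(A :: 'a set) \<pi> as. circuit_fun le (C (?n (card A))) (enc A \<tau> \<pi>))"
    by (rule definable_circuit_fun[OF depth])
  then show ?thesis
    by (rule definable_cong) (simp add: f length_enc)
qed

lemma definable_on_encodings:
  fixes f :: "'k::comm_semiring_1 list \<Rightarrow> 'k"
  assumes "definable le Ops \<tau> 0 (\<lambda>(A :: 'a::linorder set) \<pi> as. f (enc A \<tau> \<pi>))"
  obtains \<sigma> \<rho> \<phi> where "is_sentence Ops \<tau> \<sigma> \<phi>" "admissible Arb \<sigma> \<rho>"
    "EVAL TYPE('a) le \<tau> \<rho> \<phi> = on_encodings TYPE('a) \<tau> f"
proof -
  obtain \<sigma> \<rho> \<phi> where adm: "admissible Arb \<sigma> \<rho>"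
    and def: "expresses le Ops \<tau> \<sigma> \<rho> 0 \<phi> (\<lambda>(A :: 'a set) \<pi> as. f (enc A \<tau> \<pi>))"
    using assms by (auto simp: definable_def)
  have "is_sentence Ops \<tau> \<sigma> \<phi>"
    using def by (simp add: is_sentence_def expresses_def)
  moreover have "EVAL TYPE('a) le \<tau> \<rho> \<phi> = on_encodings TYPE('a) \<tau> f"
    \<comment> \<open>Without free variables the condition on assignments is vacuous, so
      \<open>\<lambda>_. undefined\<close> is allowed.\<close>
    by (rule EVAL_eqI) (use def in \<open>simp add: expresses_def\<close>)
  ultimately show ?thesis
    using that adm by blast
qed

theorem theorem35:
  fixes le :: "'k::comm_semiring_1 \<Rightarrow> 'k \<Rightarrow> bool"
    and Ops :: "cmp set"
    and \<tau> :: vocab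
  assumes "positive_semiring TYPE('k)"
    and "LE \<in> Ops \<or> NLE \<in> Ops \<Longrightarrow> semiring_order le"
    and "\<tau> \<noteq> []"
  shows "FO TYPE('a::linorder) le Ops Arb \<tau> = on_encodings TYPE('a) \<tau> ` FAC0 le Ops"
proof (rule subset_antisym)
  show "FO TYPE('a) le Ops Arb \<tau> \<subseteq> on_encodings TYPE('a) \<tau> ` FAC0 le Ops"
    unfolding FO_def using EVAL_eq_on_encodings[OF assms(3)] by blast
  show "on_encodings TYPE('a) \<tau> ` FAC0 le Ops \<subseteq> FO TYPE('a) le Ops Arb \<tau>"
  proof (rule image_subsetI)
    fix f assume "f \<in> FAC0 le Ops"
    then obtain \<sigma> \<rho> \<phi> where "is_sentence Ops \<tau> \<sigma> \<phi>" "admissible Arb \<sigma> \<rho>"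
      "EVAL TYPE('a) le \<tau> \<rho> \<phi> = on_encodings TYPE('a) \<tau> f"
      by (rule definable_on_encodings[OF FAC0_definable[OF assms(3)]])
    then show "on_encodings TYPE('a) \<tau> f \<in> FO TYPE('a) le Ops Arb \<tau>"
      unfolding FO_def by blast
  qed
qed

end
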